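(* If the class of semistrong-P-rankable sets is closed under complementation, then $\mathrm{P}=\mathrm{UP}\cap\mathrm{coUP}$.
   Context: $\Sigma=\{0,1\}$; strings are ordered in length-lexicographic order, and natural numbers are identified with strings in the standard way. For $A\subseteq\Sigma^*$, $\mathrm{rank}_A(y)=\|\{z\mid z\le y \wedge z\in A\}\|$. A set $A$ is semistrong-P-rankable if there is a total polynomial-time computable function $f$ such that $f(x)=\mathrm{rank}_A(x)$ for every $x\in A$, and for every $x\notin A$, $f(x)$ outputs a special indication ``not in set''. UP is the class of languages accepted by nondeterministic polynomial-time machines having at most one accepting path on every input; $\mathrm{coUP}$ is the class of complements of UP languages. *)

theory Defs
  imports "HOL-Computational_Algebra.Polynomial"
begin

section \<open>Strings, length-lexicographic order, and natural numbers\<close>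

text \<open>\<^const>\<open>False\<close> is the symbol 0 and \<^const>\<open>True\<close> is the symbol 1; the head of the
  list is the leftmost symbol.\<close>

type_synonym str = "bool list"

definition str_less :: "str \<Rightarrow> str \<Rightarrow> bool" where
  "str_less x y \<longleftrightarrow> (x, y) \<in> lenlex {(False, True)}"

definition str_le :: "str \<Rightarrow> str \<Rightarrow> bool" where
  "str_le x y \<longleftrightarrow> str_less x y \<or> x = y"

text \<open>The standard identification sends a string to the number of strings preceding it, so the
  empty string is 0, the string 0 is 1, the string 1 is 2, the string 00 is 3, and so on.\<close>

definition num_of_str :: "str \<Rightarrow> nat" where
  "num_of_str x = card {z. str_less z x}"

definition str_of_num :: "nat \<Rightarrow> str" where
  "str_of_num = inv num_of_str"

definition rank_in :: "str set \<Rightarrow> str \<Rightarrow> nat" where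
  "rank_in A y = card {z. str_le z y \<and> z \<in> A}"


section \<open>Multitape Turing machines\<close>

text \<open>Tapes are infinite in both directions. A transition reads one symbol per tape and, on
  each tape, writes a symbol and then moves the head by at most one cell. A machine is
  nondeterministic in general.\<close>

datatype symbol = Blank | Bit bool | Aux nat

datatype move = Left | Stay | Right

type_synonym tape = "int \<Rightarrow> symbol"

type_synonym config = "nat \<times> (tape \<times> int) list"

type_synonym transition = "(nat \<times> symbol list) \<times> (nat \<times> (symbol \<times> move) list)"

record tm =
  tape_count :: nat
  transitions :: "transition set"
  start_state :: nat
  accept_state :: nat

text \<open>Finiteness of the transition set bounds both the states and the tape alphabet in use.\<close>

definition wf_tm :: "tm \<Rightarrow> bool" where
  "wf_tm M \<longleftrightarrow> tape_count M \<ge> 1 \<and> finite (transitions M) \<and>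
    (\<forall>((q, ss), (q', as)) \<in> transitions M.
      length ss = tape_count M \<and> length as = tape_count M)"

definition deterministic :: "tm \<Rightarrow> bool" where
  "deterministic M \<longleftrightarrow> single_valued (transitions M)"

fun shift :: "move \<Rightarrow> int" where
  "shift Left = -1"
| "shift Stay = 0"
| "shift Right = 1"

fun act :: "symbol \<times> move \<Rightarrow> tape \<times> int \<Rightarrow> tape \<times> int" where
  "act (s, m) (t, i) = (t(i := s), i + shift m)"

definition scanned :: "(tape \<times> int) list \<Rightarrow> symbol list" where
  "scanned ts = map (\<lambda>(t, i). t i) ts"

definition step :: "tm \<Rightarrow> config \<Rightarrow> config \<Rightarrow> bool" where
  "step M c d \<longleftrightarrow> (\<exists>as. ((fst c, scanned (snd c)), (fst d, as)) \<in> transitions M \<and>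
    snd d = map2 act as (snd c))"

definition halted :: "tm \<Rightarrow> config \<Rightarrow> bool" where
  "halted M c \<longleftrightarrow> (\<nexists>d. step M c d)"

definition str_tape :: "str \<Rightarrow> tape" where
  "str_tape x i = (if 0 \<le> i \<and> i < int (length x) then Bit (x ! nat i) else Blank)"

text \<open>Initially the input occupies the first tape from cell 0 on, all other tapes are blank, and
  all heads are on cell 0.\<close>

definition init_config :: "tm \<Rightarrow> str \<Rightarrow> config" where
  "init_config M x =
    (start_state M, (str_tape x, 0) # replicate (tape_count M - 1) (\<lambda>_. Blank, 0))"

text \<open>Distinct applicable transitions always yield distinct configurations (see
  \<open>map2_act_inj\<close> below), so sequences of configurations
  correspond one-to-one to sequences of nondeterministic choices.\<close>

definition computation_path :: "tm \<Rightarrow> str \<Rightarrow> config list \<Rightarrow> bool" where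
  "computation_path M x cs \<longleftrightarrow> cs \<noteq> [] \<and> hd cs = init_config M x \<and> successively (step M) cs"

definition complete_path :: "tm \<Rightarrow> str \<Rightarrow> config list \<Rightarrow> bool" where
  "complete_path M x cs \<longleftrightarrow> computation_path M x cs \<and> halted M (last cs)"

definition accepting_path :: "tm \<Rightarrow> str \<Rightarrow> config list \<Rightarrow> bool" where
  "accepting_path M x cs \<longleftrightarrow> complete_path M x cs \<and> fst (last cs) = accept_state M"

definition language :: "tm \<Rightarrow> str set" where
  "language M = {x. \<exists>cs. accepting_path M x cs}"

text \<open>The bound applies to all paths, complete or not, so in particular every path halts.\<close>

definition poly_time :: "tm \<Rightarrow> bool" where
  "poly_time M \<longleftrightarrow>
    (\<exists>p :: nat poly. \<forall>x cs. computation_path M x cs \<longrightarrow> length cs - 1 \<le> poly p (length x))"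


section \<open>Complexity classes\<close>

definition class_P :: "str set set" where
  "class_P = {language M | M. wf_tm M \<and> deterministic M \<and> poly_time M}"

definition class_UP :: "str set set" where
  "class_UP = {language M | M. wf_tm M \<and> poly_time M \<and>
    (\<forall>x cs ds. accepting_path M x cs \<longrightarrow> accepting_path M x ds \<longrightarrow> cs = ds)}"

definition class_coUP :: "str set set" where
  "class_coUP = {- L | L. L \<in> class_UP}"

text \<open>The output is the content of the last tape upon halting.\<close>

definition polytime_computable :: "(str \<Rightarrow> str) \<Rightarrow> bool" where
  "polytime_computable f \<longleftrightarrow> (\<exists>M. wf_tm M \<and> deterministic M \<and> poly_time M \<and>
    (\<forall>x cs. complete_path M x cs \<longrightarrow> fst (last (snd (last cs))) = str_tape (f x)))"


section \<open>Semistrong rankability\<close>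

text \<open>The indication ``not in set'' is \<^const>\<open>None\<close>, which is output as the empty string;
  a number is output as the string identified with it, preceded by a 1.\<close>

fun output_of :: "nat option \<Rightarrow> str" where
  "output_of None = []"
| "output_of (Some n) = True # str_of_num n"

definition semistrong_P_rankable :: "str set \<Rightarrow> bool" where
  "semistrong_P_rankable A \<longleftrightarrow> (\<exists>f :: str \<Rightarrow> nat option.
    polytime_computable (\<lambda>x. output_of (f x)) \<and>
    (\<forall>x. x \<in> A \<longrightarrow> f x = Some (rank_in A x)) \<and>
    (\<forall>x. x \<notin> A \<longrightarrow> f x = None))"


section \<open>Basic facts\<close>

lemma finite_str_less: "finite {z. str_less z x}"
proof (rule finite_subset)
  show "{z. str_less z x} \<subseteq> {z. set z \<subseteq> UNIV \<and> length z \<le> length x}"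
    by (auto simp: str_less_def lenlex_conv)
  show "finite {z :: str. set z \<subseteq> UNIV \<and> length z \<le> length x}"
    by (rule finite_lists_length_le) simp
qed

lemma finite_str_le: "finite {z. str_le z y \<and> z \<in> A}"
  by (rule finite_subset[of _ "insert y {z. str_less z y}"])
    (auto simp: str_le_def finite_str_less)

lemma str_less_linear: "str_less x y \<or> x = y \<or> str_less y x"
proof -
  have "total {(False, True)}"
    by (auto simp: total_on_def)
  then have "total (lenlex {(False, True)})"
    by (rule total_lenlex)
  then show ?thesis
    by (auto simp: str_less_def total_on_def)
qed

lemma str_less_trans: "str_less x y \<Longrightarrow> str_less y z \<Longrightarrow> str_less x z"
proof -
  have "trans {(False, True)}"
    by (auto simp: trans_def)
  then have "trans (lenlex {(False, True)})"
    by (rule lenlex_transI)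
  then show "str_less x y \<Longrightarrow> str_less y z \<Longrightarrow> str_less x z"
    unfolding str_less_def by (rule transD)
qed

lemma wf_str_less: "wf {(x, y). str_less x y}"
proof -
  have "wf {(False, True)}"
    by (rule finite_acyclic_wf) (auto simp: acyclic_def trancl_insert)
  then show ?thesis
    by (simp add: str_less_def wf_lenlex)
qed

lemma num_of_str_mono: "str_less x y \<Longrightarrow> num_of_str x < num_of_str y"
  unfolding num_of_str_def
proof (rule psubset_card_mono[OF finite_str_less])
  assume "str_less x y"
  moreover have "\<not> str_less x x"
    using wf_not_refl[OF wf_str_less] by blast
  ultimately show "{z. str_less z x} \<subset> {z. str_less z y}"
    using str_less_trans by blast
qed

lemma bij_num_of_str: "bij num_of_str"
proof (rule bijI)
  show inj: "inj num_of_str"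
    by (rule injI) (metis less_irrefl num_of_str_mono str_less_linear)
  show "surj num_of_str"
    unfolding surj_def
  proof (rule allI)
    fix n
    let ?S = "{z. num_of_str z < n}"
    have img: "num_of_str ` ?S \<subseteq> {..<n}"
      by auto
    then have fin: "finite ?S"
      by (meson finite_lessThan finite_subset inj finite_imageD inj_on_subset subset_UNIV)
    have "infinite (UNIV :: str set)"
      by (simp add: infinite_UNIV_listI)
    then obtain w where "w \<in> - ?S"
      using fin by (metis Compl_UNIV_eq ComplI UNIV_eq_I)
    then obtain z where z: "z \<in> - ?S" and least: "\<And>y. str_less y z \<Longrightarrow> y \<notin> - ?S"
      using wfE_min[OF wf_str_less, of w "- ?S"] by auto
    have "{y. str_less y z} = ?S"
    proof
      show "{y. str_less y z} \<subseteq> ?S"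
        using least by auto
      show "?S \<subseteq> {y. str_less y z}"
      proof
        fix y
        assume "y \<in> ?S"
        then show "y \<in> {y. str_less y z}"
          using z str_less_linear[of y z] num_of_str_mono[of z y] by auto
      qed
    qed
    then have "num_of_str z = card ?S"
      by (simp add: num_of_str_def)
    also have "\<dots> \<le> card {..<n}"
      by (rule card_inj_on_le[OF _ img]) (use inj inj_on_subset in auto)
    finally have "num_of_str z = n"
      using z by simp
    then show "\<exists>z. n = num_of_str z"
      by blast
  qed
qed

lemma map2_act_inj:
  assumes "length as = length ts" and "length bs = length ts"
    and "map2 act as ts = map2 act bs ts"
  shows "as = bs"
proof (rule nth_equalityI)
  show "length as = length bs"
    using assms by simp
  fix i
  assume "i < length as"
  then have i: "i < length ts"
    using assms by simp
  have "map2 act as ts ! i = map2 act bs ts ! i"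
    using assms(3) by simp
  then have eq: "act (as ! i) (ts ! i) = act (bs ! i) (ts ! i)"
    using i assms(1,2) by simp
  obtain s m s' m' t p where "as ! i = (s, m)" "bs ! i = (s', m')" "ts ! i = (t, p)"
    by (metis surj_pair)
  moreover from this eq have "s = s'"
    by (auto dest: fun_upd_eqD)
  moreover have "m = m'" if "shift m = shift m'"
    using that by (cases m; cases m') auto
  ultimately show "as ! i = bs ! i"
    using eq by auto
qed

end

theory Submission
  imports Defs
begin

text \<open>Given unambiguous machines for \<open>L\<close> and \<open>- L\<close>, let \<open>A\<close> consist of the blocks
  \<open>(x, c, b, w)\<close> in which \<open>c\<close> is an arbitrary bit and the bits \<open>w\<close>, padded to a length that
  depends only on the length of \<open>x\<close>, describe an accepting path on \<open>x\<close> of the machine selected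
  by \<open>b\<close>. As every \<open>x\<close> has exactly one witness \<open>(b, w)\<close>, the rank in \<open>A\<close> of the block of
  \<open>(x, c)\<close> is the number of the string \<open>xc\<close>, so \<open>A\<close> is semistrong-P-rankable. The block
  \<open>(x, 0, 0, 1\<dots>1)\<close> never belongs to \<open>A\<close> and separates the potential witnesses for \<open>x \<in> L\<close>
  from those for \<open>x \<notin> L\<close>. Hence the parity of its rank in \<open>- A\<close> decides whether \<open>x \<in> L\<close>.\<close>

text \<open>The ranking function of the complement gives ranks only outside \<open>blocks\<close>,
  so the string that separates the two kinds of witnesses must itself be a known non-member. This
  dictates the coding of paths: every bit 1 performs a step, hence an all-ones string longer than
  the time bound describes no run, although it is the greatest string of its length. The free bit
  \<open>c\<close> does two jobs. It indexes the members by the nonempty strings \<open>xc\<close>;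
  the missing empty string offsets the shift by one in counting, so the rank is output as
  \<open>1xc\<close>, copied from the input without arithmetic. It also makes the members belonging
  to smaller \<open>x\<close> come in pairs, so the parity of the rank of the query depends only on
  the block of \<open>(x, 0)\<close>. The number of the query is even because the query ends in 1,
  and parity passes to the complement by counting. For blocks to be ordered like the strings
  \<open>xc\<close>, the padded length must depend on \<open>length x\<close> alone and
  monotonically. Machines must reproduce this length both when writing a query and when checking a
  block; a clock of \<open>C\<close> sweeping counters provides \<open>(n + 2)^C - 1\<close>, above
  any given polynomial for suitable \<open>C\<close>.\<close>

section \<open>Deterministic programs\<close>

type_synonym 'q program = "'q \<Rightarrow> symbol list \<Rightarrow> ('q \<times> (symbol \<times> move) list) option"

inductive runs :: "'q program \<Rightarrow> nat \<Rightarrow> 'q \<times> (tape \<times> int) list \<Rightarrow> 'q \<times> (tape \<times> int) list \<Rightarrow> bool"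
  for \<delta> where
  runs_0: "runs \<delta> 0 c c"
| runs_Suc: "\<delta> q (scanned ts) = Some (q', as) \<Longrightarrow> runs \<delta> t (q', map2 act as ts) c \<Longrightarrow>
    runs \<delta> (Suc t) (q, ts) c"

lemma runs_trans: "runs \<delta> s c d \<Longrightarrow> runs \<delta> t d e \<Longrightarrow> runs \<delta> (s + t) c e"
  by (induction rule: runs.induct) (auto intro: runs_Suc)

lemma runs_1: "\<delta> q (scanned ts) = Some (q', as) \<Longrightarrow> c = (q', map2 act as ts) \<Longrightarrow> runs \<delta> 1 (q, ts) c"
  using runs_Suc[OF _ runs_0] by fastforce

definition start_tapes :: "nat \<Rightarrow> str \<Rightarrow> (tape \<times> int) list" where
  "start_tapes k x = (str_tape x, 0) # replicate (k - 1) (\<lambda>_. Blank, 0)"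

lemma init_config_eq: "init_config M x = (start_state M, start_tapes (tape_count M) x)"
  by (simp add: init_config_def start_tapes_def)

lemma length_start_tapes [simp]: "k \<ge> 1 \<Longrightarrow> length (start_tapes k x) = k"
  by (simp add: start_tapes_def)

lemma length_scanned [simp]: "length (scanned ts) = length ts"
  by (simp add: scanned_def)

lemma scanned_append [simp]: "scanned (ts @ us) = scanned ts @ scanned us"
  by (simp add: scanned_def)

lemma scanned_simps [simp]:
  "scanned [] = []" "scanned (p # ts) = fst p (snd p) # scanned ts"
  by (auto simp: scanned_def split: prod.splits)

lemma set_scanned: "set (scanned ts) \<subseteq> (\<Union>p \<in> set ts. range (fst p))"
  by (auto simp: scanned_def)

lemma str_tape_Nil [simp]: "str_tape [] = (\<lambda>_. Blank)"
  by (auto simp: str_tape_def)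


subsection \<open>Paths of deterministic machines\<close>

lemma step_deterministic:
  assumes "deterministic M" "step M c d" "step M c e"
  shows "d = e"
  using assms unfolding step_def deterministic_def single_valued_def
  by (metis prod.collapse prod.inject)

text \<open>Determinism leaves one continuation, so every path is a prefix of the given run and
  cannot pass its halted end. Incomplete paths are included because \<open>poly_time\<close> bounds
  them as well.\<close>

lemma deterministic_path:
  assumes "deterministic M" "(step M ^^ t) c d" "halted M d"
    and "successively (step M) cs" "cs \<noteq> []" "hd cs = c"
  shows "length cs - 1 \<le> t \<and> (halted M (last cs) \<longrightarrow> last cs = d)"
  using assms(2,4-6)
proof (induction t arbitrary: c cs)
  case 0
  then have "c = d"
    by simp
  then have "tl cs = []"
    using 0 assms(3) unfolding halted_def by (cases cs; cases "tl cs") auto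
  then show ?case
    using 0 \<open>c = d\<close> by (cases cs) auto
next
  case (Suc t)
  obtain e where e: "step M c e" "(step M ^^ t) e d"
    using Suc.prems(1) by (meson relpowp_Suc_D2)
  obtain cs' where cs: "cs = c # cs'"
    using Suc.prems by (cases cs) auto
  show ?case
  proof (cases "cs' = []")
    case True
    then show ?thesis
      using e(1) unfolding halted_def
      by (auto simp: cs simp del: split_paired_Ex split_paired_All)
  next
    case False
    then have s: "step M c (hd cs')" "successively (step M) cs'"
      using Suc.prems(2) by (auto simp: cs successively_Cons)
    then have "hd cs' = e"
      using step_deterministic[OF assms(1) e(1)] by metis
    then have "length cs' - 1 \<le> t \<and> (halted M (last cs') \<longrightarrow> last cs' = d)"
      using Suc.IH[OF e(2) s(2) False] by auto
    then show ?thesis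
      using False by (auto simp: cs)
  qed
qed

lemma relpowp_path:
  "(step M ^^ t) c d \<Longrightarrow>
    \<exists>cs. successively (step M) cs \<and> cs \<noteq> [] \<and> hd cs = c \<and> last cs = d \<and> length cs = Suc t"
proof (induction t arbitrary: c)
  case 0
  then show ?case
    by (intro exI[of _ "[c]"]) auto
next
  case (Suc t)
  obtain e where e: "step M c e" "(step M ^^ t) e d"
    using Suc.prems by (meson relpowp_Suc_D2)
  from Suc.IH[OF e(2)] obtain cs where
    "successively (step M) cs" "cs \<noteq> []" "hd cs = e" "last cs = d" "length cs = Suc t"
    by blast
  then show ?case
    using e(1) by (intro exI[of _ "c # cs"]) (auto simp: successively_Cons)
qed

lemma deterministic_accepting_path:
  assumes "deterministic M" "(step M ^^ t) (init_config M x) d" "halted M d"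
  shows "x \<in> language M \<longleftrightarrow> fst d = accept_state M"
proof
  assume "x \<in> language M"
  then show "fst d = accept_state M"
    using deterministic_path[OF assms]
    by (auto simp: language_def accepting_path_def complete_path_def computation_path_def)
next
  assume "fst d = accept_state M"
  then show "x \<in> language M"
    using relpowp_path[OF assms(2)] assms(3)
    unfolding language_def accepting_path_def complete_path_def computation_path_def by blast
qed

lemma deterministic_path_unique:
  assumes "deterministic M" "successively (step M) cs" "successively (step M) ds"
    and "cs \<noteq> []" "ds \<noteq> []" "hd cs = hd ds" "halted M (last cs)" "halted M (last ds)"
  shows "cs = ds"
  using assms(2-)
proof (induction cs arbitrary: ds)
  case (Cons c cs)
  obtain ds' where ds: "ds = c # ds'"
    using Cons.prems by (cases ds) auto
  show ?case
  proof (cases "cs = [] \<or> ds' = []")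
    case True
    moreover have "\<not> halted M c" if "cs \<noteq> [] \<or> ds' \<noteq> []"
      using that Cons.prems unfolding halted_def
      by (auto simp: ds successively_Cons simp del: split_paired_Ex split_paired_All split: if_splits)
    ultimately show ?thesis
      using Cons.prems by (cases "cs = []"; cases "ds' = []") (simp_all add: ds)
  next
    case False
    then have "step M c (hd cs)" "step M c (hd ds')"
      using Cons.prems by (auto simp: ds successively_Cons)
    then have "hd cs = hd ds'"
      using step_deterministic[OF assms(1)] by blast
    then show ?thesis
      using Cons.IH[of ds'] Cons.prems False by (auto simp: ds successively_Cons)
  qed
qed simp

lemma class_P_subset_class_UP: "class_P \<subseteq> class_UP"
proof
  fix L
  assume "L \<in> class_P"
  then obtain M where M: "L = language M" "wf_tm M" "deterministic M" "poly_time M"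
    by (auto simp: class_P_def)
  have "cs = ds" if "accepting_path M x cs" "accepting_path M x ds" for x cs ds
    using deterministic_path_unique[OF M(3)] that
    by (auto simp: accepting_path_def complete_path_def computation_path_def)
  then show "L \<in> class_UP"
    using M by (auto simp: class_UP_def)
qed

text \<open>If no run within the bound halted, runs could be prolonged to any length, against the
  bound. The first conjunct serves the nondeterministic UP machines, the second the deterministic
  ones.\<close>

lemma poly_time_halting_run:
  assumes "poly_time M"
  shows "\<exists>p. (\<forall>x t d. (step M ^^ t) (init_config M x) d \<longrightarrow> t \<le> poly p (length x)) \<and>
    (\<forall>x. \<exists>t d. (step M ^^ t) (init_config M x) d \<and> halted M d \<and> t \<le> poly p (length x))"
proof -
  from assms obtain p where
    p: "\<And>x cs. computation_path M x cs \<Longrightarrow> length cs - 1 \<le> poly p (length x)"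
    by (auto simp: poly_time_def)
  have bound: "t \<le> poly p (length x)" if "(step M ^^ t) (init_config M x) d" for x t d
    using relpowp_path[OF that] p[of x] unfolding computation_path_def by fastforce
  have "\<exists>t d. (step M ^^ t) (init_config M x) d \<and> halted M d \<and> t \<le> poly p (length x)" for x
  proof (rule ccontr)
    assume no: "\<not> ?thesis"
    have "\<exists>d. (step M ^^ t) (init_config M x) d" for t
    proof (induction t)
      case (Suc t)
      then obtain d where d: "(step M ^^ t) (init_config M x) d"
        by blast
      then have "\<not> halted M d"
        using no bound by blast
      then show ?case
        using d by (meson halted_def relpowp_Suc_I)
    qed auto
    then show False
      using bound by (meson Suc_n_not_le_n)
  qed
  then show ?thesis
    using bound by blast
qed

lemma poly_mono_nat: "m \<le> n \<Longrightarrow> poly p m \<le> poly (p :: nat poly) n"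
  by (induction p) (auto intro: add_mono mult_mono)


subsection \<open>Realizing programs by machines\<close>

text \<open>\<open>\<delta>\<close> may be defined on infinitely many arguments. Only its
  restriction to the finite sets \<open>Q\<close> and \<open>\<Gamma>\<close> becomes a transition
  table, and \<open>closed\<close> keeps runs inside this restriction.\<close>

locale program =
  fixes k :: nat and Q :: "'q set" and \<Gamma> :: "symbol set" and \<delta> :: "'q program" and q\<^sub>0 :: 'q
  assumes k: "k \<ge> 1"
    and finite: "finite Q" "finite \<Gamma>"
    and q\<^sub>0: "q\<^sub>0 \<in> Q"
    and symbols: "Blank \<in> \<Gamma>" "Bit b \<in> \<Gamma>"
    and closed: "q \<in> Q \<Longrightarrow> length ss = k \<Longrightarrow> set ss \<subseteq> \<Gamma> \<Longrightarrow> \<delta> q ss = Some (q', as) \<Longrightarrow>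
      q' \<in> Q \<and> length as = k \<and> fst ` set as \<subseteq> \<Gamma>"
begin

definition code :: "'q \<Rightarrow> nat" where
  "code = (SOME f. inj_on f Q)"

lemma inj_code: "inj_on code Q"
  unfolding code_def using finite_imp_inj_to_nat_seg[OF finite(1)] by (metis someI)

definition machine :: "'q \<Rightarrow> tm" where
  "machine q\<^sub>a = \<lparr>tape_count = k,
    transitions = {((code q, ss), (code q', as)) | q ss q' as.
      q \<in> Q \<and> length ss = k \<and> set ss \<subseteq> \<Gamma> \<and> \<delta> q ss = Some (q', as)},
    start_state = code q\<^sub>0, accept_state = code q\<^sub>a\<rparr>"

lemma wf_machine: "wf_tm (machine q\<^sub>a)"
proof -
  let ?T = "transitions (machine q\<^sub>a)"
  let ?S = "Q \<times> {ss. set ss \<subseteq> \<Gamma> \<and> length ss = k}"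
  have "?T \<subseteq> (\<lambda>(q, ss). ((code q, ss), map_prod code id (the (\<delta> q ss)))) ` ?S"
    by (force simp: machine_def image_iff)
  moreover have "finite ?S"
    using finite by (simp add: finite_lists_length_eq)
  ultimately have "finite ?T"
    by (meson finite_imageI finite_subset)
  then show ?thesis
    using k closed by (auto simp: wf_tm_def machine_def)
qed

lemma deterministic_machine: "deterministic (machine q\<^sub>a)"
  using inj_code by (auto simp: deterministic_def single_valued_def machine_def dest: inj_onD)

definition valid :: "'q \<times> (tape \<times> int) list \<Rightarrow> bool" where
  "valid c \<longleftrightarrow> fst c \<in> Q \<and> length (snd c) = k \<and> (\<forall>p \<in> set (snd c). range (fst p) \<subseteq> \<Gamma>)"

lemma valid_scanned: "valid c \<Longrightarrow> set (scanned (snd c)) \<subseteq> \<Gamma>"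
  using set_scanned[of "snd c"] by (fastforce simp: valid_def)

text \<open>A valid configuration scans only symbols of \<open>\<Gamma>\<close>, so the restricted
  transition table loses nothing; injectivity of \<open>code\<close> recovers the program
  state.\<close>

lemma step_machine_iff:
  assumes "valid (q, ts)"
  shows "step (machine q\<^sub>a) (code q, ts) d \<longleftrightarrow>
    (\<exists>q' as. \<delta> q (scanned ts) = Some (q', as) \<and> d = (code q', map2 act as ts))"
proof -
  have "q \<in> Q" "length (scanned ts) = k" "set (scanned ts) \<subseteq> \<Gamma>"
    using assms valid_scanned[of "(q, ts)"] by (auto simp: valid_def)
  then show ?thesis
    using inj_code unfolding step_def machine_def
    by (cases d) (auto dest: inj_onD)
qed

lemma valid_step:
  assumes "valid (q, ts)" "\<delta> q (scanned ts) = Some (q', as)"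
  shows "valid (q', map2 act as ts)"
proof -
  have as: "q' \<in> Q" "length as = k" "fst ` set as \<subseteq> \<Gamma>"
    using closed[OF _ _ _ assms(2)] assms(1) valid_scanned[of "(q, ts)"] by (auto simp: valid_def)
  have "range (fst (act a p)) \<subseteq> \<Gamma>" if "(a, p) \<in> set (zip as ts)" for a p
  proof -
    have "a \<in> set as" "p \<in> set ts"
      using that by (meson set_zip_leftD set_zip_rightD)+
    then have "fst a \<in> \<Gamma>" "range (fst p) \<subseteq> \<Gamma>"
      using as(3) assms(1) by (auto simp: valid_def)
    then show ?thesis
      by (cases a; cases p) auto
  qed
  then have "range (fst p) \<subseteq> \<Gamma>" if "p \<in> set (map2 act as ts)" for p
    using that by (clarsimp simp del: act.simps) blast
  then show ?thesis
    using as assms(1) by (simp add: valid_def)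
qed

lemma runs_machine:
  "runs \<delta> t c d \<Longrightarrow> valid c \<Longrightarrow>
    (step (machine q\<^sub>a) ^^ t) (code (fst c), snd c) (code (fst d), snd d) \<and> valid d"
proof (induction rule: runs.induct)
  case (runs_Suc q ts q' as t c)
  then have "step (machine q\<^sub>a) (code q, ts) (code q', map2 act as ts)"
    using step_machine_iff by blast
  moreover have "valid (q', map2 act as ts)"
    using runs_Suc valid_step by blast
  ultimately show ?case
    using runs_Suc.IH by (metis fst_conv relpowp_Suc_I2 snd_conv)
qed simp

lemma valid_start: "valid (q\<^sub>0, start_tapes k x)"
proof -
  have "range (str_tape x) \<subseteq> \<Gamma>"
    using symbols by (auto simp: str_tape_def)
  then show ?thesis
    using k symbols q\<^sub>0 by (auto simp: valid_def start_tapes_def)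
qed

lemma machine_run:
  assumes "runs \<delta> t (q\<^sub>0, start_tapes k x) (q, ts)" "\<delta> q (scanned ts) = None"
  shows "(step (machine q\<^sub>a) ^^ t) (init_config (machine q\<^sub>a) x) (code q, ts)"
    and "halted (machine q\<^sub>a) (code q, ts)" and "q \<in> Q"
proof -
  have "init_config (machine q\<^sub>a) x = (code q\<^sub>0, start_tapes k x)"
    by (simp add: init_config_eq machine_def)
  then show "(step (machine q\<^sub>a) ^^ t) (init_config (machine q\<^sub>a) x) (code q, ts)"
    using runs_machine[OF assms(1) valid_start] by simp
  have "valid (q, ts)"
    using runs_machine[OF assms(1) valid_start] by simp
  then show "halted (machine q\<^sub>a) (code q, ts)" "q \<in> Q"
    using step_machine_iff assms(2) by (auto simp: halted_def valid_def)
qed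

lemma poly_time_machine:
  assumes "\<And>x. \<exists>t q ts. runs \<delta> t (q\<^sub>0, start_tapes k x) (q, ts) \<and> \<delta> q (scanned ts) = None \<and>
    t \<le> poly p (length x)"
  shows "poly_time (machine q\<^sub>a)"
proof -
  have "length cs - 1 \<le> poly p (length x)" if cs: "computation_path (machine q\<^sub>a) x cs" for x cs
  proof -
    obtain t q ts where t: "runs \<delta> t (q\<^sub>0, start_tapes k x) (q, ts)" "\<delta> q (scanned ts) = None"
      "t \<le> poly p (length x)"
      using assms by blast
    then show ?thesis
      using deterministic_path[OF deterministic_machine machine_run(1,2)[OF t(1,2)]] cs
      by (fastforce simp: computation_path_def)
  qed
  then show ?thesis
    by (auto simp: poly_time_def)
qed

lemma polytime_computableI:
  assumes "\<And>x. \<exists>t q ts. runs \<delta> t (q\<^sub>0, start_tapes k x) (q, ts) \<and> \<delta> q (scanned ts) = None \<and>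
    t \<le> poly p (length x) \<and> fst (last ts) = str_tape (f x)"
  shows "polytime_computable f"
  unfolding polytime_computable_def
proof (intro exI conjI allI impI)
  show "poly_time (machine q\<^sub>0)"
    using assms by (intro poly_time_machine) blast
  fix x cs
  assume cs: "complete_path (machine q\<^sub>0) x cs"
  obtain t q ts where t: "runs \<delta> t (q\<^sub>0, start_tapes k x) (q, ts)" "\<delta> q (scanned ts) = None"
    "fst (last ts) = str_tape (f x)"
    using assms by blast
  then have "last cs = (code q, ts)"
    using deterministic_path[OF deterministic_machine machine_run(1,2)[OF t(1,2)]] cs
    by (auto simp: complete_path_def computation_path_def)
  then show "fst (last (snd (last cs))) = str_tape (f x)"
    using t(3) by simp
qed (use wf_machine deterministic_machine in auto)

lemma class_PI:
  assumes "\<And>x. \<exists>t q ts. runs \<delta> t (q\<^sub>0, start_tapes k x) (q, ts) \<and> \<delta> q (scanned ts) = None \<and>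
    t \<le> poly p (length x) \<and> (q = q\<^sub>a \<longleftrightarrow> x \<in> L)"
    and "q\<^sub>a \<in> Q"
  shows "L \<in> class_P"
proof -
  have "poly_time (machine q\<^sub>a)"
    using assms(1) by (intro poly_time_machine) blast
  moreover have "x \<in> language (machine q\<^sub>a) \<longleftrightarrow> x \<in> L" for x
  proof -
    obtain t q ts where t: "runs \<delta> t (q\<^sub>0, start_tapes k x) (q, ts)" "\<delta> q (scanned ts) = None"
      "q = q\<^sub>a \<longleftrightarrow> x \<in> L"
      using assms(1) by blast
    note m = machine_run(1,2)[OF t(1,2), where q\<^sub>a = q\<^sub>a] machine_run(3)[OF t(1,2)]
    have "x \<in> language (machine q\<^sub>a) \<longleftrightarrow> code q = code q\<^sub>a"
      using deterministic_accepting_path[OF deterministic_machine m(1,2)] by (simp add: machine_def)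
    then show ?thesis
      using t(3) inj_code m(3) assms(2) by (auto dest: inj_onD)
  qed
  ultimately show ?thesis
    unfolding class_P_def using wf_machine[of q\<^sub>a] deterministic_machine[of q\<^sub>a] by blast
qed

end


subsection \<open>Machines as programs\<close>

text \<open>For a deterministic machine the choice is forced (\<open>program_of_eq_Some\<close>).
  Closure and halting hold for any choice, so determinism need not be carried along once the runs
  have been obtained.\<close>

definition program_of :: "tm \<Rightarrow> nat program" where
  "program_of M q ss = (if \<exists>r. ((q, ss), r) \<in> transitions M
    then Some (SOME r. ((q, ss), r) \<in> transitions M) else None)"

text \<open>A run meets only the start state and targets of transitions; the accept state is added
  so that it can be named as a state of the new machines.\<close>

definition states_of :: "tm \<Rightarrow> nat set" where
  "states_of M = {start_state M, accept_state M} \<union> (fst \<circ> snd) ` transitions M"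

definition symbols_of :: "tm \<Rightarrow> symbol set" where
  "symbols_of M = {Blank, Bit False, Bit True} \<union> (\<Union>r \<in> transitions M. fst ` set (snd (snd r)))"

lemma finite_states_of: "wf_tm M \<Longrightarrow> finite (states_of M)"
  by (auto simp: states_of_def wf_tm_def)

lemma finite_symbols_of: "wf_tm M \<Longrightarrow> finite (symbols_of M)"
  by (auto simp: symbols_of_def wf_tm_def)

lemma program_of_SomeD:
  assumes "program_of M q ss = Some (q', as)"
  shows "((q, ss), (q', as)) \<in> transitions M"
  using assms unfolding program_of_def by (metis option.discI option.inject someI_ex)

lemma program_of_closed:
  assumes "wf_tm M" "program_of M q ss = Some (q', as)"
  shows "q' \<in> states_of M \<and> length as = tape_count M \<and> fst ` set as \<subseteq> symbols_of M"
proof -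
  note t = program_of_SomeD[OF assms(2)]
  have "q' \<in> states_of M"
    using t by (force simp: states_of_def)
  moreover have "fst ` set as \<subseteq> symbols_of M"
    using t by (force simp: symbols_of_def)
  moreover have "length as = tape_count M"
    using t assms(1) by (auto simp: wf_tm_def)
  ultimately show ?thesis
    by blast
qed

lemma program_of_eq_Some:
  assumes "deterministic M"
  shows "program_of M q ss = Some r \<longleftrightarrow> ((q, ss), r) \<in> transitions M"
  using assms program_of_SomeD[of M q ss "fst r" "snd r"]
  unfolding deterministic_def single_valued_def program_of_def
  by (metis option.inject prod.collapse someI_ex)

lemma program_of_halted: "program_of M q (scanned ts) = None \<longleftrightarrow> halted M (q, ts)"
  by (auto simp: program_of_def halted_def step_def)

lemma runs_program_of:
  "deterministic M \<Longrightarrow> (step M ^^ t) c d \<Longrightarrow> runs (program_of M) t c d"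
proof (induction t arbitrary: c)
  case 0
  then show ?case
    by (auto intro: runs_0)
next
  case (Suc t)
  then obtain e where e: "step M c e" "(step M ^^ t) e d"
    by (meson relpowp_Suc_D2)
  then obtain as where "((fst c, scanned (snd c)), (fst e, as)) \<in> transitions M"
    "snd e = map2 act as (snd c)"
    by (auto simp: step_def)
  moreover have "runs (program_of M) t e d"
    using Suc e(2) by blast
  ultimately show ?case
    using Suc.prems(1) runs_Suc[of "program_of M" "fst c" "snd c" "fst e" as t d]
    by (simp add: program_of_eq_Some) (metis prod.collapse)
qed


definition stay :: "symbol list \<Rightarrow> (symbol \<times> move) list" where
  "stay ss = map (\<lambda>s. (s, Stay)) ss"

lemma length_stay [simp]: "length (stay ss) = length ss"
  by (simp add: stay_def)

lemma symbols_stay [simp]: "fst ` set (stay ss) = set ss"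
  by (force simp: stay_def)

lemma in_set_stay [simp]: "(s, m) \<in> set (stay ss) \<longleftrightarrow> s \<in> set ss \<and> m = Stay"
  by (auto simp: stay_def)

lemma stay_simps [simp]:
  "stay [] = []" "stay (s # ss) = (s, Stay) # stay ss" "stay (ss @ ss') = stay ss @ stay ss'"
  by (simp_all add: stay_def)

lemma map2_act_stay [simp]: "map2 act (stay (scanned ts)) ts = ts"
  by (induction ts) (auto simp: stay_def)

lemma last_map2: "length as = length ts \<Longrightarrow> ts \<noteq> [] \<Longrightarrow> last (map2 f as ts) = f (last as) (last ts)"
  by (induction as ts rule: list_induct2) auto

lemma start_state_in [simp]: "start_state M \<in> states_of M" "accept_state M \<in> states_of M"
  by (auto simp: states_of_def)

lemma symbols_of_basic [simp]: "Blank \<in> symbols_of M" "Bit b \<in> symbols_of M"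
  by (cases b; auto simp: symbols_of_def)+

lemma tape_count_pos: "wf_tm M \<Longrightarrow> tape_count M \<ge> Suc 0"
  by (simp add: wf_tm_def)

lemma class_PE:
  assumes "L \<in> class_P"
  obtains M p where "wf_tm M" and "\<And>x. \<exists>t q ts.
    runs (program_of M) t (start_state M, start_tapes (tape_count M) x) (q, ts) \<and>
    program_of M q (scanned ts) = None \<and> t \<le> poly p (length x) \<and>
    (q = accept_state M \<longleftrightarrow> x \<in> L)"
proof -
  from assms obtain M where M: "L = language M" "wf_tm M" "deterministic M" "poly_time M"
    by (auto simp: class_P_def)
  from poly_time_halting_run[OF M(4)] obtain p where
    p: "\<And>x. \<exists>t d. (step M ^^ t) (init_config M x) d \<and> halted M d \<and> t \<le> poly p (length x)"
    by blast
  have "\<exists>t q ts. runs (program_of M) t (start_state M, start_tapes (tape_count M) x) (q, ts) \<and>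
    program_of M q (scanned ts) = None \<and> t \<le> poly p (length x) \<and>
    (q = accept_state M \<longleftrightarrow> x \<in> L)" for x
  proof -
    obtain t q ts where t: "(step M ^^ t) (init_config M x) (q, ts)" "halted M (q, ts)"
      "t \<le> poly p (length x)"
      using p by (metis prod.collapse)
    then show ?thesis
      using runs_program_of[OF M(3) t(1)] deterministic_accepting_path[OF M(3) t(1,2)] M(1)
      by (auto simp: init_config_eq program_of_halted)
  qed
  then show thesis
    using that M(2) by blast
qed

lemma polytime_computableE:
  assumes "polytime_computable f"
  obtains M p where "wf_tm M" and "\<And>x. \<exists>t q ts.
    runs (program_of M) t (start_state M, start_tapes (tape_count M) x) (q, ts) \<and>
    program_of M q (scanned ts) = None \<and> t \<le> poly p (length x) \<and>
    fst (last ts) = str_tape (f x)"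
proof -
  from assms obtain M where M: "wf_tm M" "deterministic M" "poly_time M"
    "\<And>x cs. complete_path M x cs \<Longrightarrow> fst (last (snd (last cs))) = str_tape (f x)"
    by (auto simp: polytime_computable_def)
  from poly_time_halting_run[OF M(3)] obtain p where
    p: "\<And>x. \<exists>t d. (step M ^^ t) (init_config M x) d \<and> halted M d \<and> t \<le> poly p (length x)"
    by blast
  have "\<exists>t q ts. runs (program_of M) t (start_state M, start_tapes (tape_count M) x) (q, ts) \<and>
    program_of M q (scanned ts) = None \<and> t \<le> poly p (length x) \<and>
    fst (last ts) = str_tape (f x)" for x
  proof -
    obtain t q ts where t: "(step M ^^ t) (init_config M x) (q, ts)" "halted M (q, ts)"
      "t \<le> poly p (length x)"
      using p by (metis prod.collapse)
    obtain cs where "complete_path M x cs" "last cs = (q, ts)"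
      using relpowp_path[OF t(1)] t(2) unfolding complete_path_def computation_path_def by metis
    then have "fst (last ts) = str_tape (f x)"
      using M(4) by fastforce
    then show ?thesis
      using t(2,3) runs_program_of[OF M(2) t(1)]
      by (auto simp: init_config_eq program_of_halted)
  qed
  then show thesis
    using that M(1) by blast
qed

lemma runs_program_of_length:
  "runs (program_of M) t c d \<Longrightarrow> wf_tm M \<Longrightarrow> length (snd c) = tape_count M \<Longrightarrow>
    length (snd d) = tape_count M"
  by (induction rule: runs.induct) (auto dest: program_of_closed)


subsection \<open>Closure of P under complement\<close>

text \<open>Exchanging accepting and rejecting states is impossible, as there is one accept state
  but possibly many rejecting ones. The new state \<open>None\<close> collects the latter, at the
  cost of one extra step, and becomes the accept state.\<close>

definition compl_program :: "tm \<Rightarrow> nat option program" where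
  "compl_program M r ss = (case r of None \<Rightarrow> None
    | Some q \<Rightarrow> (case program_of M q ss of
        Some (q', as) \<Rightarrow> Some (Some q', as)
      | None \<Rightarrow> if q = accept_state M then None else Some (None, stay ss)))"

lemma runs_compl_program:
  "runs (program_of M) t c d \<Longrightarrow>
    runs (compl_program M) t (Some (fst c), snd c) (Some (fst d), snd d)"
  by (induction rule: runs.induct) (auto simp: compl_program_def intro: runs_0 runs_Suc)

lemma class_P_compl:
  assumes "L \<in> class_P"
  shows "- L \<in> class_P"
proof -
  obtain M p where M: "wf_tm M" "\<And>x. \<exists>t q ts.
    runs (program_of M) t (start_state M, start_tapes (tape_count M) x) (q, ts) \<and>
    program_of M q (scanned ts) = None \<and> t \<le> poly p (length x) \<and>
    (q = accept_state M \<longleftrightarrow> x \<in> L)"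
    using class_PE[OF assms] by blast
  interpret program "tape_count M" "insert None (Some ` states_of M)" "symbols_of M"
    "compl_program M" "Some (start_state M)"
    by unfold_locales (use M(1) in \<open>auto simp: tape_count_pos finite_states_of finite_symbols_of
      compl_program_def program_of_closed[OF M(1)] dest: program_of_closed[OF M(1)]
      split: option.splits if_splits\<close>)
  have "\<exists>t q ts. runs (compl_program M) t (Some (start_state M), start_tapes (tape_count M) x) (q, ts) \<and>
    compl_program M q (scanned ts) = None \<and> t \<le> poly (p + 1) (length x) \<and>
    (q = None \<longleftrightarrow> x \<in> - L)" for x
  proof -
    obtain t q ts where t:
      "runs (program_of M) t (start_state M, start_tapes (tape_count M) x) (q, ts)"
      "program_of M q (scanned ts) = None" "t \<le> poly p (length x)" "q = accept_state M \<longleftrightarrow> x \<in> L"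
      using M(2) by blast
    have r: "runs (compl_program M) t (Some (start_state M), start_tapes (tape_count M) x) (Some q, ts)"
      using runs_compl_program[OF t(1)] by simp
    show ?thesis
    proof (cases "x \<in> L")
      case True
      then show ?thesis
        using r t by (intro exI[of _ t] exI[of _ "Some q"] exI[of _ ts]) (auto simp: compl_program_def)
    next
      case False
      then have "runs (compl_program M) 1 (Some q, ts) (None, ts)"
        using t by (intro runs_1) (auto simp: compl_program_def)
      from runs_trans[OF r this] show ?thesis
        using False t
        by (intro exI[of _ "t + 1"] exI[of _ "None"] exI[of _ ts]) (auto simp: compl_program_def)
    qed
  qed
  then show ?thesis
    by (rule class_PI) simp
qed


subsection \<open>Closure of P under polynomial-time reductions\<close>

datatype reduction_state = Begin | Compute nat bool | Seek bool | Decide nat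

text \<open>The output tape of the first machine is the input tape of the second one. A final shadow
  tape, marked at cell 0, moves in parallel with it, and the flag records on which side of cell 0 its
  head currently is, so that the head can be brought back to cell 0 before the second machine starts.\<close>

definition reduction_program :: "tm \<Rightarrow> tm \<Rightarrow> reduction_state program" where
  "reduction_program H M r ss = (case r of
    Begin \<Rightarrow> Some (Compute (start_state H) False, stay (butlast ss) @ [(Aux 0, Stay)])
  | Compute q b \<Rightarrow> (case program_of H q (take (tape_count H) ss) of
      Some (q', as) \<Rightarrow> Some (Compute q' (if last ss = Aux 0 then snd (last as) = Right else b),
        as @ stay (butlast (drop (tape_count H) ss)) @ [(last ss, snd (last as))])
    | None \<Rightarrow> Some (Seek b, stay ss))
  | Seek b \<Rightarrow> (if last ss = Aux 0 then Some (Decide (start_state M), stay ss)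
      else let m = if b then Left else Right in
        Some (Seek b, stay (take (tape_count H - 1) ss) @ [(ss ! (tape_count H - 1), m)] @
          stay (butlast (drop (tape_count H) ss)) @ [(last ss, m)]))
  | Decide q \<Rightarrow> (case program_of M q (take (tape_count M) (drop (tape_count H - 1) ss)) of
      Some (q', as) \<Rightarrow> Some (Decide q', stay (take (tape_count H - 1) ss) @ as @ stay [last ss])
    | None \<Rightarrow> None))"

definition mark_tape :: tape where
  "mark_tape = (\<lambda>_. Blank)(0 := Aux 0)"

lemma mark_tape_iff [simp]: "mark_tape i = Aux 0 \<longleftrightarrow> i = 0"
  by (auto simp: mark_tape_def)

text \<open>Sharing the output tape of \<open>H\<close> with the input tape of \<open>M\<close>
  saves one tape and the shadow tape adds one, hence the plain sum of the tape counts.\<close>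

lemma program_reduction_program:
  assumes "wf_tm H" "wf_tm M"
  shows "program (tape_count H + tape_count M)
    (insert Begin ((\<Union>b. (\<lambda>q. Compute q b) ` states_of H) \<union> range Seek \<union> Decide ` states_of M))
    (insert (Aux 0) (symbols_of H \<union> symbols_of M)) (reduction_program H M) Begin"
    (is "program ?k ?Q ?\<Gamma> _ _")
proof
  fix q ss q' as
  assume q: "q \<in> ?Q" "length ss = ?k" "set ss \<subseteq> ?\<Gamma>"
    and step: "reduction_program H M q ss = Some (q', as)"
  have k: "tape_count H \<ge> 1" "tape_count M \<ge> 1"
    using assms tape_count_pos by auto
  have "ss \<noteq> []" "tape_count H - 1 < length ss"
    using k q(2) by auto
  then have "last ss \<in> ?\<Gamma>" "ss ! (tape_count H - 1) \<in> ?\<Gamma>"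
    using q(3) last_in_set nth_mem by blast+
  moreover have "set (butlast ss) \<subseteq> ?\<Gamma>" "\<And>n. set (take n ss) \<subseteq> ?\<Gamma>"
    "\<And>n. set (butlast (drop n ss)) \<subseteq> ?\<Gamma>"
    using q(3) by (auto dest!: in_set_takeD in_set_butlastD in_set_dropD)
  moreover note \<open>ss \<noteq> []\<close>
  ultimately have ss: "ss \<noteq> []" "last ss \<in> ?\<Gamma>" "set (butlast ss) \<subseteq> ?\<Gamma>" "\<And>n. set (take n ss) \<subseteq> ?\<Gamma>"
    "\<And>n. set (butlast (drop n ss)) \<subseteq> ?\<Gamma>" "ss ! (tape_count H - 1) \<in> ?\<Gamma>"
    by blast+
  show "q' \<in> ?Q \<and> length as = ?k \<and> fst ` set as \<subseteq> ?\<Gamma>"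
  proof (cases q)
    case Begin
    then show ?thesis
      using step ss(3) q(2) k imageI[OF start_state_in(1)[of H], of "\<lambda>p. Compute p False"]
      by (auto simp: reduction_program_def image_Un)
  next
    case (Compute p b)
    show ?thesis
    proof (cases "program_of H p (take (tape_count H) ss)")
      case None
      then show ?thesis
        using step Compute q by (auto simp: reduction_program_def)
    next
      case (Some r)
      obtain p' bs where r: "r = (p', bs)"
        by fastforce
      have p': "p' \<in> states_of H" "length bs = tape_count H" "fst ` set bs \<subseteq> symbols_of H"
        using program_of_closed[OF assms(1) Some[unfolded r]] by auto
      define b' where "b' = (if last ss = Aux 0 then snd (last bs) = Right else b)"
      have q': "q' = Compute p' b'"
        and as: "as = bs @ stay (butlast (drop (tape_count H) ss)) @ [(last ss, snd (last bs))]"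
        using step Compute Some by (auto simp: reduction_program_def r b'_def)
      have "fst ` set as = fst ` set bs \<union> set (butlast (drop (tape_count H) ss)) \<union> {last ss}"
        unfolding as by (simp add: image_Un)
      then have "fst ` set as \<subseteq> ?\<Gamma>"
        using ss(2) ss(5)[of "tape_count H"] subset_trans[OF p'(3), of ?\<Gamma>] by auto
      moreover have "q' \<in> ?Q"
        unfolding q' using p'(1) by blast
      ultimately show ?thesis
        using p'(2) q(2) k by (simp add: as)
    qed
  next
    case (Seek b)
    show ?thesis
    proof (cases "last ss = Aux 0")
      case True
      then show ?thesis
        using step Seek q(2,3) by (auto simp: reduction_program_def)
    next
      case False
      define m where "m = (if b then Left else Right)"
      have q': "q' = Seek b"
        and as: "as = stay (take (tape_count H - 1) ss) @ [(ss ! (tape_count H - 1), m)] @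
          stay (butlast (drop (tape_count H) ss)) @ [(last ss, m)]"
        using step Seek False by (auto simp: reduction_program_def Let_def m_def)
      have "fst ` set as = set (take (tape_count H - 1) ss) \<union> {ss ! (tape_count H - 1)} \<union>
          set (butlast (drop (tape_count H) ss)) \<union> {last ss}"
        unfolding as by (simp add: image_Un insert_commute)
      then have "fst ` set as \<subseteq> ?\<Gamma>"
        using ss(2,6) ss(4)[of "tape_count H - 1"] ss(5)[of "tape_count H"] by simp
      then show ?thesis
        using q(2) k by (simp add: q' as)
    qed
  next
    case (Decide p)
    obtain p' bs where r: "program_of M p (take (tape_count M) (drop (tape_count H - 1) ss)) = Some (p', bs)"
      using step Decide by (auto simp: reduction_program_def split: option.splits)
    have p': "p' \<in> states_of M" "length bs = tape_count M" "fst ` set bs \<subseteq> symbols_of M"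
      using program_of_closed[OF assms(2) r] by auto
    have q': "q' = Decide p'" and as: "as = stay (take (tape_count H - 1) ss) @ bs @ stay [last ss]"
      using step Decide r by (auto simp: reduction_program_def)
    have "fst ` set as = set (take (tape_count H - 1) ss) \<union> fst ` set bs \<union> {last ss}"
      unfolding as by (simp add: image_Un)
    then have "fst ` set as \<subseteq> ?\<Gamma>"
      using ss(2) ss(4)[of "tape_count H - 1"] subset_trans[OF p'(3), of ?\<Gamma>] by auto
    then show ?thesis
      using p'(1,2) q(2) k by (simp add: q' as)
  qed
qed (use assms in \<open>auto simp: tape_count_pos finite_states_of finite_symbols_of trans_le_add1\<close>)

text \<open>At cell 0 the flag is unconstrained: there the mark is visible, the search ends, and the
  flag is renewed by the next move of the simulated head.\<close>

definition side_flag :: "bool \<Rightarrow> int \<Rightarrow> bool" where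
  "side_flag b i \<longleftrightarrow> (i > 0 \<longrightarrow> b) \<and> (i < 0 \<longrightarrow> \<not> b)"

lemma act_snd: "snd (act a p) = snd p + shift (snd a)"
  by (cases a; cases p) simp

text \<open>A head moves by at most one cell, so it changes sides only through cell 0, where the
  mark triggers the update of the flag. The tapes \<open>us\<close> wait for
  \<open>M\<close>.\<close>

lemma runs_Compute:
  assumes "wf_tm H"
  shows "runs (program_of H) t c d \<Longrightarrow> length (snd c) = tape_count H \<Longrightarrow>
    side_flag b (snd (last (snd c))) \<Longrightarrow>
    \<exists>b'. side_flag b' (snd (last (snd d))) \<and>
      runs (reduction_program H M) t
        (Compute (fst c) b, snd c @ us @ [(mark_tape, snd (last (snd c)))])
        (Compute (fst d) b', snd d @ us @ [(mark_tape, snd (last (snd d)))])"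
proof (induction arbitrary: b rule: runs.induct)
  case (runs_0 c)
  then show ?case
    using runs.runs_0 by blast
next
  case (runs_Suc q ts q' as t c)
  have as: "length as = tape_count H"
    using program_of_closed[OF assms runs_Suc.hyps(1)] by blast
  have ne: "ts \<noteq> []"
    using runs_Suc.prems tape_count_pos[OF assms] by auto
  define i where "i = snd (last ts)"
  define m where "m = snd (last as)"
  define b' where "b' = (if i = 0 then m = Right else b)"
  have pos: "snd (last (map2 act as ts)) = i + shift m"
    using as runs_Suc.prems ne by (simp add: last_map2 act_snd i_def m_def)
  have "side_flag b' (i + shift m)"
    using runs_Suc.prems by (cases m) (auto simp: side_flag_def b'_def i_def)
  then obtain b'' where b'': "side_flag b'' (snd (last (snd c)))"
    "runs (reduction_program H M) t (Compute q' b', map2 act as ts @ us @ [(mark_tape, i + shift m)])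
      (Compute (fst c) b'', snd c @ us @ [(mark_tape, snd (last (snd c)))])"
    using runs_Suc.IH[of b'] as runs_Suc.prems pos by auto
  let ?ts = "ts @ us @ [(mark_tape, i)]"
  have "reduction_program H M (Compute q b) (scanned ?ts) =
    Some (Compute q' b', as @ stay (scanned us) @ [(mark_tape i, m)])"
    using runs_Suc.hyps(1) runs_Suc.prems by (simp add: reduction_program_def b'_def m_def)
  moreover have "map2 act (as @ stay (scanned us) @ [(mark_tape i, m)]) ?ts =
    map2 act as ts @ us @ [(mark_tape, i + shift m)]"
    using as runs_Suc.prems by simp
  ultimately show ?case
    using runs.runs_Suc[of "reduction_program H M" "Compute q b" ?ts] b'' unfolding i_def by fastforce
qed

lemma runs_Decide:
  assumes "wf_tm M" "length us = tape_count H - 1"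
  shows "runs (program_of M) t c d \<Longrightarrow> length (snd c) = tape_count M \<Longrightarrow>
    runs (reduction_program H M) t (Decide (fst c), us @ snd c @ [p]) (Decide (fst d), us @ snd d @ [p])"
proof (induction rule: runs.induct)
  case (runs_0 c)
  show ?case
    by (rule runs.runs_0)
next
  case (runs_Suc q ts q' as t c)
  have as: "length as = tape_count M"
    using program_of_closed[OF assms(1) runs_Suc.hyps(1)] by blast
  let ?ts = "us @ ts @ [p]"
  have "reduction_program H M (Decide q) (scanned ?ts) =
    Some (Decide q', stay (scanned us) @ as @ stay (scanned [p]))"
    using runs_Suc.hyps(1) runs_Suc.prems assms(2) by (simp add: reduction_program_def)
  moreover have "map2 act (stay (scanned us) @ as @ stay (scanned [p])) ?ts = us @ map2 act as ts @ [p]"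
    using as runs_Suc.prems assms(2) by (simp del: scanned_simps)
  moreover have "runs (reduction_program H M) t (Decide q', us @ map2 act as ts @ [p])
      (Decide (fst c), us @ snd c @ [p])"
    using runs_Suc.IH as runs_Suc.prems by simp
  ultimately show ?case
    using runs.runs_Suc[of "reduction_program H M" "Decide q" ?ts] by fastforce
qed

lemma runs_Seek:
  assumes "length us = tape_count H - 1" "tape_count H \<ge> 1"
  shows "nat \<bar>i\<bar> = n \<Longrightarrow> side_flag b i \<Longrightarrow>
    runs (reduction_program H M) n
      (Seek b, us @ [(y, i)] @ vs @ [(mark_tape, i)]) (Seek b, us @ [(y, 0)] @ vs @ [(mark_tape, 0)])"
proof (induction n arbitrary: i)
  case 0
  then show ?case
    by (simp add: runs_0)
next
  case (Suc n)
  define m where "m = (if b then Left else Right)"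
  let ?ts = "us @ [(y, i)] @ vs @ [(mark_tape, i)]"
  have "length us < tape_count H" "drop (tape_count H) (scanned us) = []"
    "tape_count H - length us = Suc 0"
    using assms by auto
  then have "reduction_program H M (Seek b) (scanned ?ts) =
    Some (Seek b, stay (scanned us) @ [(y i, m)] @ stay (scanned vs) @ [(mark_tape i, m)])"
    using Suc.prems assms by (simp add: reduction_program_def Let_def m_def nth_append)
  moreover have "map2 act (stay (scanned us) @ [(y i, m)] @ stay (scanned vs) @ [(mark_tape i, m)]) ?ts =
     us @ [(y, i + shift m)] @ vs @ [(mark_tape, i + shift m)]"
    by simp
  moreover have "nat \<bar>i + shift m\<bar> = n" "side_flag b (i + shift m)"
    using Suc.prems by (auto simp: side_flag_def m_def split: if_splits)
  ultimately show ?case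
    using Suc.IH runs_Suc[of "reduction_program H M" "Seek b" ?ts] by fastforce
qed

text \<open>Each step extends the reach of the last head by at most one cell. The bound on its
  position limits the way back to cell 0, and the bound on the nonblank cells limits the length of
  the output.\<close>

lemma runs_program_of_extent:
  assumes "wf_tm M"
  shows "runs (program_of M) t c d \<Longrightarrow> length (snd c) = tape_count M \<Longrightarrow>
    \<bar>snd (last (snd c))\<bar> \<le> B \<Longrightarrow> (\<forall>j > B. fst (last (snd c)) j = Blank) \<Longrightarrow>
    \<bar>snd (last (snd d))\<bar> \<le> B + int t \<and> (\<forall>j > B + int t. fst (last (snd d)) j = Blank)"
proof (induction arbitrary: B rule: runs.induct)
  case (runs_Suc q ts q' as t c)
  have as: "length as = tape_count M"
    using program_of_closed[OF assms runs_Suc.hyps(1)] by blast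
  have "ts \<noteq> []"
    using runs_Suc.prems tape_count_pos[OF assms] by auto
  then have l: "last (map2 act as ts) = act (last as) (last ts)"
    using as runs_Suc.prems by (simp add: last_map2)
  obtain s m y i where "last as = (s, m)" "last ts = (y, i)"
    by (meson surj_pair)
  then have "\<bar>snd (last (map2 act as ts))\<bar> \<le> B + 1 \<and>
      (\<forall>j > B + 1. fst (last (map2 act as ts)) j = Blank)"
    using runs_Suc.prems l by (cases m) auto
  then show ?case
    using runs_Suc.IH[of "B + 1"] as runs_Suc.prems by (simp add: algebra_simps)
qed simp

lemma class_P_reduction:
  assumes "polytime_computable h" "L \<in> class_P"
  shows "{x. h x \<in> L} \<in> class_P"
proof -
  obtain H p where H: "wf_tm H" "\<And>x. \<exists>t q ts.
    runs (program_of H) t (start_state H, start_tapes (tape_count H) x) (q, ts) \<and>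
    program_of H q (scanned ts) = None \<and> t \<le> poly p (length x) \<and> fst (last ts) = str_tape (h x)"
    using polytime_computableE[OF assms(1)] by blast
  obtain M r where M: "wf_tm M" "\<And>x. \<exists>t q ts.
    runs (program_of M) t (start_state M, start_tapes (tape_count M) x) (q, ts) \<and>
    program_of M q (scanned ts) = None \<and> t \<le> poly r (length x) \<and>
    (q = accept_state M \<longleftrightarrow> x \<in> L)"
    using class_PE[OF assms(2)] by blast
  define kH where "kH = tape_count H"
  define kM where "kM = tape_count M"
  have k: "kH \<ge> 1" "kM \<ge> 1"
    using H(1) M(1) by (auto simp: kH_def kM_def tape_count_pos)
  let ?\<delta> = "reduction_program H M"
  \<comment> \<open>The first \<open>p\<close> pays for \<open>H\<close>;
    \<open>[:3, 1:] + p\<close> pays for three phase changes and for the way back over at most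
    \<open>length x + t\<close> cells; the composition pays for \<open>M\<close> on an input of
    length at most \<open>length x + t + 1\<close>.\<close>
  define s where "s = p + [:3, 1:] + p + pcompose r (p + [:1, 1:])"
  show ?thesis
  proof (rule program.class_PI[OF program_reduction_program[OF H(1) M(1)],
        of s "Decide (accept_state M)"])
    fix x
    obtain t q ts where t: "runs (program_of H) t (start_state H, start_tapes kH x) (q, ts)"
      "program_of H q (scanned ts) = None" "t \<le> poly p (length x)" "fst (last ts) = str_tape (h x)"
      using H(2) unfolding kH_def by blast
    obtain t' q' ts' where t': "runs (program_of M) t' (start_state M, start_tapes kM (h x)) (q', ts')"
      "program_of M q' (scanned ts') = None" "t' \<le> poly r (length (h x))"
      "q' = accept_state M \<longleftrightarrow> h x \<in> L"
      using M(2) unfolding kM_def by blast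
    have len: "length ts = kH"
      using runs_program_of_length[OF t(1) H(1)] k by (simp add: kH_def)
    have len': "length ts' = kM"
      using runs_program_of_length[OF t'(1) M(1)] k by (simp add: kM_def)
    define i where "i = snd (last ts)"
    \<comment> \<open>If \<open>H\<close> has a single tape, its last tape is the input tape; hence
      the initial extent \<open>length x\<close>.\<close>
    have "\<bar>snd (last (start_tapes kH x))\<bar> \<le> int (length x)"
      "\<forall>j > int (length x). fst (last (start_tapes kH x)) j = Blank"
      by (auto simp: start_tapes_def str_tape_def last_replicate)
    then have extent: "\<bar>i\<bar> \<le> int (length x + t)" "\<forall>j > int (length x + t). str_tape (h x) j = Blank"
      using runs_program_of_extent[OF H(1) t(1), of "int (length x)"] k t(4)
      by (auto simp: i_def kH_def)
    have "length (h x) \<le> length x + t + 1"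
    proof (rule ccontr)
      assume "\<not> ?thesis"
      then have "str_tape (h x) (int (length x + t + 1)) \<noteq> Blank"
        by (simp add: str_tape_def)
      then show False
        using extent(2) by simp
    qed
    then have "t' \<le> poly r (poly p (length x) + (1 + length x))"
      using t'(3) t(3) poly_mono_nat[of "length (h x)" "poly p (length x) + (1 + length x)" r] by linarith
    then have time: "1 + t + 1 + nat \<bar>i\<bar> + 1 + t' \<le> poly s (length x)"
      using extent(1) t(3) by (simp add: s_def poly_pcompose algebra_simps)
    define us where "us = replicate (kM - 1) (\<lambda>_ :: int. Blank, 0 :: int)"
    have start: "start_tapes (kH + kM) x = start_tapes kH x @ us @ [(\<lambda>_. Blank, 0)]"
    proof -
      have "kH + kM - 1 = (kH - 1) + ((kM - 1) + 1)"
        using k by simp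
      then show ?thesis
        by (simp only: start_tapes_def us_def replicate_add) simp
    qed
    have lastpos: "snd (last (start_tapes kH x)) = 0"
      by (simp add: start_tapes_def last_replicate)
    have r1: "runs ?\<delta> 1 (Begin, start_tapes (kH + kM) x)
      (Compute (start_state H) False, start_tapes kH x @ us @ [(mark_tape, 0)])"
      unfolding start
      by (rule runs_1) (auto simp: reduction_program_def butlast_append mark_tape_def)
    have "side_flag False 0"
      by (simp add: side_flag_def)
    then obtain b where b: "side_flag b i"
      "runs ?\<delta> t (Compute (start_state H) False, start_tapes kH x @ us @ [(mark_tape, 0)])
        (Compute q b, ts @ us @ [(mark_tape, i)])"
      using runs_Compute[OF H(1) t(1), of False M us] k lastpos by (auto simp: kH_def i_def)
    have r2: "runs ?\<delta> 1 (Compute q b, ts @ us @ [(mark_tape, i)]) (Seek b, ts @ us @ [(mark_tape, i)])"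
      by (rule runs_1[where as = "stay (scanned (ts @ us @ [(mark_tape, i)]))"])
        (use t(2) len in \<open>simp_all add: reduction_program_def kH_def\<close>)
    obtain vs where vs: "ts = vs @ [(str_tape (h x), i)]" "length vs = kH - 1"
      using len k t(4) by (metis append_butlast_last_id i_def length_butlast list.size(3)
          not_one_le_zero prod.collapse)
    have r3: "runs ?\<delta> (nat \<bar>i\<bar>) (Seek b, ts @ us @ [(mark_tape, i)])
      (Seek b, vs @ [(str_tape (h x), 0)] @ us @ [(mark_tape, 0)])"
      using runs_Seek[of vs H i "nat \<bar>i\<bar>" b M "str_tape (h x)" us] vs k b(1) by (simp add: kH_def)
    have r4: "runs ?\<delta> 1 (Seek b, vs @ [(str_tape (h x), 0)] @ us @ [(mark_tape, 0)])
      (Decide (start_state M), vs @ start_tapes kM (h x) @ [(mark_tape, 0)])"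
      by (rule runs_1[where as = "stay (scanned (vs @ [(str_tape (h x), 0)] @ us @ [(mark_tape, 0)]))"])
        (simp_all add: reduction_program_def start_tapes_def us_def)
    have r5: "runs ?\<delta> t' (Decide (start_state M), vs @ start_tapes kM (h x) @ [(mark_tape, 0)])
      (Decide q', vs @ ts' @ [(mark_tape, 0)])"
      using runs_Decide[OF M(1) _ t'(1), of vs H] vs(2) k by (simp add: kH_def kM_def)
    have "?\<delta> (Decide q') (scanned (vs @ ts' @ [(mark_tape, 0)])) = None"
      using t'(2) len' vs(2) by (simp add: reduction_program_def kM_def kH_def)
    moreover note runs_trans[OF runs_trans[OF runs_trans[OF runs_trans[OF runs_trans[OF r1 b(2)] r2] r3] r4] r5]
    moreover have "Decide q' = Decide (accept_state M) \<longleftrightarrow> x \<in> {x. h x \<in> L}"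
      using t'(4) by simp
    ultimately show "\<exists>t q ts. runs ?\<delta> t (Begin, start_tapes (tape_count H + tape_count M) x) (q, ts) \<and>
        ?\<delta> q (scanned ts) = None \<and> t \<le> poly s (length x) \<and>
        (q = Decide (accept_state M) \<longleftrightarrow> x \<in> {x. h x \<in> L})"
      using time unfolding kH_def kM_def by blast
  qed simp
qed


subsection \<open>Reading off the last bit\<close>

fun last_bit_program :: "nat program" where
  "last_bit_program 0 [Bit b] = Some (0, [(Bit b, Right)])"
| "last_bit_program 0 [Blank] = Some (1, [(Blank, Left)])"
| "last_bit_program (Suc 0) [Bit True] = Some (2, [(Bit True, Stay)])"
| "last_bit_program _ _ = None"

lemma runs_last_bit:
  "n \<le> length x \<Longrightarrow>
    runs last_bit_program n (0, [(str_tape x, 0)]) (0, [(str_tape x, int n)])"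
proof (induction n)
  case (Suc n)
  have "runs last_bit_program 1 (0, [(str_tape x, int n)]) (0, [(str_tape x, int (Suc n))])"
    by (rule runs_1[of _ _ _ _ "[(Bit (x ! n), Right)]"])
      (use Suc.prems in \<open>auto simp: str_tape_def fun_eq_iff\<close>)
  then show ?case
    using runs_trans[OF Suc.IH] Suc.prems by fastforce
qed (simp add: runs_0)

text \<open>This set is what both reductions finally lead to: the last symbol of an output carries
  the parity of the rank.\<close>

lemma last_bit_class_P: "{x. x \<noteq> [] \<and> last x} \<in> class_P"
proof -
  interpret program 1 "{0, 1, 2}" "{Blank, Bit False, Bit True}" last_bit_program 0
  proof
    fix q ss q' as
    assume "last_bit_program q ss = Some (q', as)"
    then show "q' \<in> {0, 1, 2} \<and> length as = 1 \<and> fst ` set as \<subseteq> {Blank, Bit False, Bit True}"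
      by (cases "(q, ss)" rule: last_bit_program.cases) (auto split: if_splits)
  qed auto
  show ?thesis
  proof (rule class_PI[of "[:2, 1:]" 2])
    fix x
    have "runs last_bit_program (length x) (0, start_tapes 1 x) (0, [(str_tape x, int (length x))])"
      using runs_last_bit[of "length x" x] by (simp add: start_tapes_def)
    moreover have "runs last_bit_program 1 (0, [(str_tape x, int (length x))])
      (1, [(str_tape x, int (length x) - 1)])"
      by (rule runs_1[of _ _ _ _ "[(Blank, Left)]"]) (auto simp: str_tape_def fun_eq_iff)
    ultimately have r: "runs last_bit_program (length x + 1) (0, start_tapes 1 x)
      (1, [(str_tape x, int (length x) - 1)])"
      by (rule runs_trans)
    show "\<exists>t q ts. runs last_bit_program t (0, start_tapes 1 x) (q, ts) \<and>
      last_bit_program q (scanned ts) = None \<and> t \<le> poly [:2, 1:] (length x) \<and>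
      (q = 2 \<longleftrightarrow> x \<in> {x. x \<noteq> [] \<and> last x})"
    proof (cases "x \<noteq> [] \<and> last x")
      case True
      then have "str_tape x (int (length x) - 1) = Bit True"
        by (auto simp: str_tape_def last_conv_nth nat_diff_distrib nat_minus_as_int)
      then have "runs last_bit_program 1 (1, [(str_tape x, int (length x) - 1)])
        (2, [(str_tape x, int (length x) - 1)])"
        by (intro runs_1[of _ _ _ _ "[(Bit True, Stay)]"]) (auto simp: fun_eq_iff)
      from runs_trans[OF r this] show ?thesis
        using True by (intro exI conjI) (auto simp: numeral_2_eq_2)
    next
      case False
      then have "str_tape x (int (length x) - 1) \<noteq> Bit True"
        by (cases "x = []") (auto simp: str_tape_def last_conv_nth nat_diff_distrib nat_minus_as_int)
      then have "last_bit_program 1 [str_tape x (int (length x) - 1)] = None"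
        by (cases "str_tape x (int (length x) - 1)") auto
      then show ?thesis
        using False r by (intro exI conjI) auto
    qed
  qed simp
qed


section \<open>Ranks of strings\<close>

lemma str_less_iff:
  "str_less x y \<longleftrightarrow> length x < length y \<or>
    length x = length y \<and> (\<exists>p u v. x = p @ False # u \<and> y = p @ True # v)"
  by (auto simp: str_less_def lenlex_conv lex_conv)

lemma str_less_irrefl [simp]: "\<not> str_less x x"
  using num_of_str_mono by blast

lemma str_less_append_left: "str_less u v \<Longrightarrow> str_less (p @ u) (p @ v)"
  unfolding str_less_iff by (metis (no_types, lifting) append.assoc length_append nat_add_left_cancel_less)

text \<open>Strings of equal length either differ before the last position, where the order is
  already decided, or agree up to it, so the last bit only breaks ties.\<close>

lemma str_less_snoc: "str_less (z @ [b]) (u @ [a]) \<longleftrightarrow> str_less z u \<or> z = u \<and> \<not> b \<and> a"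
proof
  assume l: "str_less (z @ [b]) (u @ [a])"
  show "str_less z u \<or> z = u \<and> \<not> b \<and> a"
  proof (cases "length z = length u")
    case True
    then obtain p v w where p: "z @ [b] = p @ False # v" "u @ [a] = p @ True # w"
      using l by (auto simp: str_less_iff)
    have "length v = length w"
      using True p by (metis add_left_cancel length_Cons length_append length_append_singleton old.nat.inject)
    show ?thesis
    proof (cases v rule: rev_cases)
      case Nil
      then show ?thesis
        using p \<open>length v = length w\<close> by auto
    next
      case (snoc v' b')
      then obtain w' a' where "w = w' @ [a']"
        using \<open>length v = length w\<close> by (cases w rule: rev_cases) auto
      then have "z = p @ False # v'" "u = p @ True # w'"
        using p snoc by (metis append.assoc append_Cons butlast_snoc)+
      then show ?thesis
        using True by (auto simp: str_less_iff)
    qed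
  next
    case False
    then show ?thesis
      using l by (auto simp: str_less_iff)
  qed
next
  assume "str_less z u \<or> z = u \<and> \<not> b \<and> a"
  then show "str_less (z @ [b]) (u @ [a])"
  proof
    assume "str_less z u"
    then show ?thesis
      unfolding str_less_iff by fastforce
  qed (auto simp: str_less_iff)
qed

lemma num_of_str_Nil [simp]: "num_of_str [] = 0"
  by (simp add: num_of_str_def str_less_iff)

text \<open>The predecessors of \<open>ua\<close> are the empty string, both one-bit extensions of
  every predecessor of \<open>u\<close>, and also \<open>u0\<close> if \<open>a\<close> is 1. This
  is bijective base 2 numeration with the digits 1 and 2.\<close>

lemma num_of_str_snoc: "num_of_str (u @ [a]) = 2 * num_of_str u + (if a then 2 else 1)"
proof -
  let ?S = "{z. str_less z u}"
  let ?R = "if a then {u @ [False]} else {}"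
  have eq: "{z. str_less z (u @ [a])} = insert [] ((\<lambda>z. z @ [False]) ` ?S \<union> (\<lambda>z. z @ [True]) ` ?S \<union> ?R)"
    (is "?A = ?B")
  proof (rule set_eqI)
    fix z
    show "z \<in> ?A \<longleftrightarrow> z \<in> ?B"
    proof (cases z rule: rev_cases)
      case Nil
      then show ?thesis
        by (auto simp: str_less_iff)
    next
      case (snoc z' b)
      then show ?thesis
        by (cases b) (auto simp: str_less_snoc)
    qed
  qed
  have inj: "inj_on (\<lambda>z. z @ [b]) ?S" for b
    by (auto simp: inj_on_def)
  have fin: "finite ?S"
    by (rule finite_str_less)
  have "card ((\<lambda>z. z @ [False]) ` ?S \<union> (\<lambda>z. z @ [True]) ` ?S) = 2 * card ?S"
    using fin by (subst card_Un_disjoint) (auto simp: card_image inj)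
  moreover have "card ((\<lambda>z. z @ [False]) ` ?S \<union> (\<lambda>z. z @ [True]) ` ?S \<union> ?R) =
      card ((\<lambda>z. z @ [False]) ` ?S \<union> (\<lambda>z. z @ [True]) ` ?S) + card ?R"
    using fin by (intro card_Un_disjoint) auto
  moreover have "num_of_str (u @ [a]) =
      Suc (card ((\<lambda>z. z @ [False]) ` ?S \<union> (\<lambda>z. z @ [True]) ` ?S \<union> ?R))"
    unfolding num_of_str_def eq using fin by (intro card_insert_disjoint) auto
  moreover have "card ?S = num_of_str u"
    by (simp add: num_of_str_def)
  ultimately show ?thesis
    by simp
qed

lemma num_of_str_of_num [simp]: "num_of_str (str_of_num n) = n"
  unfolding str_of_num_def by (meson bij_num_of_str bij_is_surj surj_f_inv_f)

lemma str_of_num_of_str [simp]: "str_of_num (num_of_str x) = x"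
  unfolding str_of_num_def by (meson bij_num_of_str bij_is_inj inv_f_f)

text \<open>The output for \<open>n\<close> is the binary representation of \<open>n + 1\<close>.\<close>

lemma last_output_of: "last (output_of (Some n)) \<longleftrightarrow> even n"
proof (cases "str_of_num n" rule: rev_cases)
  case Nil
  then have "n = 0"
    by (metis num_of_str_Nil num_of_str_of_num)
  then show ?thesis
    using Nil by simp
next
  case (snoc u a)
  then have "n = 2 * num_of_str u + (if a then 2 else 1)"
    by (metis num_of_str_of_num num_of_str_snoc)
  then show ?thesis
    using snoc by (auto split: if_splits)
qed

lemma card_str_le: "card {z. str_le z y} = Suc (num_of_str y)"
proof -
  have "{z. str_le z y} = insert y {z. str_less z y}"
    by (auto simp: str_le_def)
  then show ?thesis
    using finite_str_less[of y] by (simp add: num_of_str_def)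
qed

lemma rank_in_compl: "rank_in A y + rank_in (- A) y = Suc (num_of_str y)"
proof -
  have "{z. str_le z y} = {z. str_le z y \<and> z \<in> A} \<union> {z. str_le z y \<and> z \<in> - A}"
    by auto
  then have "card {z. str_le z y} =
      card {z. str_le z y \<and> z \<in> A} + card {z. str_le z y \<and> z \<in> - A}"
    by (simp only:) (intro card_Un_disjoint finite_str_le, blast)
  then show ?thesis
    by (simp add: rank_in_def card_str_le)
qed


section \<open>Driving a nondeterministic machine by bits\<close>

text \<open>The bits \<open>0\<^sup>i1\<close> select the transition with index \<open>i\<close>; the index being built up saturates at
  the number of transitions.\<close>

fun bit_step :: "transition list \<Rightarrow> bool \<Rightarrow> nat \<times> config \<Rightarrow> (nat \<times> config) option" where
  "bit_step T False (i, c) = Some (min (Suc i) (length T), c)"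
| "bit_step T True (i, (q, ts)) =
    (if i < length T \<and> fst (T ! i) = (q, scanned ts)
     then Some (0, (fst (snd (T ! i)), map2 act (snd (snd (T ! i))) ts)) else None)"

fun bit_run :: "transition list \<Rightarrow> str \<Rightarrow> nat \<times> config \<Rightarrow> (nat \<times> config) option" where
  "bit_run T [] s = Some s"
| "bit_run T (b # w) s = (case bit_step T b s of None \<Rightarrow> None | Some s' \<Rightarrow> bit_run T w s')"

text \<open>The trace turns a bit string into a computation path, so that unambiguity of the machine
  can be carried over to bit strings.\<close>

fun bit_trace :: "transition list \<Rightarrow> str \<Rightarrow> nat \<times> config \<Rightarrow> config list" where
  "bit_trace T [] s = []"
| "bit_trace T (b # w) s = (case bit_step T b s of None \<Rightarrow> []
    | Some s' \<Rightarrow> if b then snd s' # bit_trace T w s' else bit_trace T w s')"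

text \<open>The final index is left free, so that trailing zeros can serve as padding.\<close>

definition bit_accepts :: "tm \<Rightarrow> transition list \<Rightarrow> str \<Rightarrow> str \<Rightarrow> bool" where
  "bit_accepts M T x w \<longleftrightarrow> (\<exists>i d. bit_run T w (0, init_config M x) = Some (i, d) \<and>
    halted M d \<and> fst d = accept_state M)"

lemma bit_run_append:
  "bit_run T (v @ w) s = (case bit_run T v s of None \<Rightarrow> None | Some s' \<Rightarrow> bit_run T w s')"
  by (induction v arbitrary: s) (auto split: option.splits)

lemma bit_run_False: "\<exists>j. bit_run T (replicate n False) (i, c) = Some (j, c)"
  by (induction n arbitrary: i) auto

lemma bit_run_replicate_False:
  "j < length T \<Longrightarrow> n \<le> j \<Longrightarrow> bit_run T (replicate n False) (j - n, c) = Some (j, c)"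
  by (induction n) (auto simp: Suc_diff_Suc min_def)

lemma path_relpowp:
  "successively (step M) cs \<Longrightarrow> cs \<noteq> [] \<Longrightarrow> (step M ^^ (length cs - 1)) (hd cs) (last cs)"
proof (induction cs)
  case (Cons c cs)
  show ?case
  proof (cases "cs = []")
    case False
    then have "step M c (hd cs)" "(step M ^^ (length cs - 1)) (hd cs) (last cs)"
      using Cons by (auto simp: successively_Cons)
    then have "(step M ^^ Suc (length cs - 1)) c (last cs)"
      by (rule relpowp_Suc_I2)
    then show ?thesis
      using False by simp
  qed simp
qed simp

locale choice_list =
  fixes M :: tm and T :: "transition list"
  assumes wf: "wf_tm M" and T: "set T = transitions M" "distinct T"
begin

lemma bit_step_True:
  "bit_step T True (i, c) = Some (j, d) \<Longrightarrow> step M c d \<and> j = 0 \<and> i < length T \<and>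
    T ! i = ((fst c, scanned (snd c)), (fst d, snd (snd (T ! i))))"
  using T(1) by (cases c; cases "T ! i"; auto simp: step_def split: if_splits) (metis nth_mem)

lemma bit_trace_path:
  "bit_run T w (i, c) = Some (j, d) \<Longrightarrow>
    successively (step M) (c # bit_trace T w (i, c)) \<and> last (c # bit_trace T w (i, c)) = d \<and>
    length (bit_trace T w (i, c)) = count_list w True"
proof (induction w arbitrary: i c)
  case (Cons b w)
  from Cons.prems obtain i' c' where s: "bit_step T b (i, c) = Some (i', c')"
    "bit_run T w (i', c') = Some (j, d)"
    by (auto split: option.splits)
  show ?case
  proof (cases b)
    case True
    then show ?thesis
      using Cons.IH[OF s(2)] s bit_step_True[of i c i' c'] by (auto simp: successively_Cons)
  next
    case False
    then show ?thesis
      using Cons.IH[OF s(2)] s by auto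
  qed
qed simp

lemma bit_accepts_path:
  assumes "bit_accepts M T x w"
  shows "accepting_path M x (init_config M x # bit_trace T w (0, init_config M x))"
proof -
  obtain i d where d: "bit_run T w (0, init_config M x) = Some (i, d)" "halted M d"
    "fst d = accept_state M"
    using assms by (auto simp: bit_accepts_def)
  then show ?thesis
    using bit_trace_path[OF d(1)]
    unfolding accepting_path_def complete_path_def computation_path_def by (metis list.sel(1) list.discI)
qed

lemma bit_accepts_language: "bit_accepts M T x w \<Longrightarrow> x \<in> language M"
  using bit_accepts_path by (auto simp: language_def)

text \<open>A step by the transition with index \<open>j < length T\<close> is spelled
  \<open>0\<^sup>j1\<close>, which takes at most \<open>length T\<close> bits.\<close>

lemma bit_run_of_path:
  "(step M ^^ t) c d \<Longrightarrow> \<exists>w. length w \<le> length T * t \<and> bit_run T w (0, c) = Some (0, d)"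
proof (induction t arbitrary: c)
  case 0
  then show ?case
    by (intro exI[of _ "[]"]) auto
next
  case (Suc t)
  obtain e where e: "step M c e" "(step M ^^ t) e d"
    using Suc.prems by (meson relpowp_Suc_D2)
  obtain w where w: "length w \<le> length T * t" "bit_run T w (0, e) = Some (0, d)"
    using Suc.IH[OF e(2)] by blast
  obtain as where as: "((fst c, scanned (snd c)), (fst e, as)) \<in> transitions M"
    "snd e = map2 act as (snd c)"
    using e(1) by (auto simp: step_def)
  then obtain j where j: "j < length T" "T ! j = ((fst c, scanned (snd c)), (fst e, as))"
    using T(1) by (metis in_set_conv_nth)
  have "bit_step T True (j, c) = Some (0, e)"
    using j as(2) by (cases c; cases e) auto
  then have "bit_run T (replicate j False @ True # w) (0, c) = Some (0, d)"
    using bit_run_replicate_False[OF j(1) order_refl, of c] w(2) by (simp add: bit_run_append)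
  then show ?case
    using j(1) w(1) by (intro exI[of _ "replicate j False @ True # w"]) auto
qed

text \<open>Zeros appended to the description of an accepting path alter only the index, so the
  description can be padded to length \<open>n\<close>.\<close>

lemma bit_accepts_exists:
  assumes "x \<in> language M" "\<And>t d. (step M ^^ t) (init_config M x) d \<Longrightarrow> length T * t \<le> n"
  shows "\<exists>w. length w = n \<and> bit_accepts M T x w"
proof -
  obtain cs where cs: "cs \<noteq> []" "hd cs = init_config M x" "successively (step M) cs"
    "halted M (last cs)" "fst (last cs) = accept_state M"
    using assms(1) by (auto simp: language_def accepting_path_def complete_path_def computation_path_def)
  have path: "(step M ^^ (length cs - 1)) (init_config M x) (last cs)"
    using path_relpowp[OF cs(3,1)] cs(2) by simp
  then obtain w where w: "length w \<le> length T * (length cs - 1)"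
    "bit_run T w (0, init_config M x) = Some (0, last cs)"
    using bit_run_of_path by blast
  then have "length w \<le> n"
    using assms(2)[OF path] by linarith
  obtain j where "bit_run T (w @ replicate (n - length w) False) (0, init_config M x) = Some (j, last cs)"
    using w(2) bit_run_False by (fastforce simp: bit_run_append)
  then show ?thesis
    using cs \<open>length w \<le> n\<close> unfolding bit_accepts_def
    by (intro exI[of _ "w @ replicate (n - length w) False"]) auto
qed

text \<open>Before the first step only zeros are read, and these never lower an index below the
  saturation value.\<close>

lemma bit_trace_first:
  "bit_run T w (i, c) = Some s \<Longrightarrow> bit_trace T w (i, c) = d # ds \<Longrightarrow>
    \<exists>j. i \<le> j \<and> bit_step T True (j, c) = Some (0, d)"
proof (induction w arbitrary: i)
  case (Cons b w)
  show ?case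
  proof (cases b)
    case True
    then obtain s' where s': "bit_step T True (i, c) = Some s'" "snd s' = d"
      using Cons.prems by (auto split: option.splits)
    then have "s' = (0, d)"
      using bit_step_True[of i c "fst s'" "snd s'"] by (cases s') auto
    then show ?thesis
      using s' by auto
  next
    case False
    show ?thesis
    proof (cases "i < length T")
      case True
      then show ?thesis
        using Cons.IH[of "min (Suc i) (length T)"] Cons.prems False by (auto dest: Suc_leD)
    next
      \<comment> \<open>An index that has reached \<open>length T\<close> stays there and selects no
        transition, so no step could follow.\<close>
      case ge: False
      then obtain j where "min (Suc i) (length T) \<le> j" "bit_step T True (j, c) = Some (0, d)"
        using Cons.IH[of "min (Suc i) (length T)"] Cons.prems False by auto
      then show ?thesis
        using ge bit_step_True[of j c 0 d] by auto
    qed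
  qed
qed simp

text \<open>Different actions on the same tapes give different configurations
  (\<open>map2_act_inj\<close>), and \<open>T\<close> has no repetitions; hence the successor
  configuration determines the index.\<close>

lemma bit_step_True_inj:
  assumes "bit_step T True (i, c) = Some (0, d)" "bit_step T True (j, c) = Some (0, d)"
    and "length (snd c) = tape_count M"
  shows "i = j"
proof -
  note i = bit_step_True[OF assms(1)] and j = bit_step_True[OF assms(2)]
  have "T ! i \<in> transitions M" "T ! j \<in> transitions M"
    using i j T(1) nth_mem by blast+
  then have len: "length (snd (snd (T ! i))) = tape_count M" "length (snd (snd (T ! j))) = tape_count M"
    using wf by (auto simp: wf_tm_def split_beta)
  have "snd d = map2 act (snd (snd (T ! i))) (snd c)" "snd d = map2 act (snd (snd (T ! j))) (snd c)"
    using assms(1,2) by (cases c; cases d; auto split: if_splits)+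
  then have "snd (snd (T ! i)) = snd (snd (T ! j))"
    using map2_act_inj[of "snd (snd (T ! i))" "snd c" "snd (snd (T ! j))"] len assms(3) by simp
  then have "T ! i = T ! j"
    using i j by metis
  then show ?thesis
    using T(2) i j by (simp add: nth_eq_iff_index_eq)
qed

lemma length_tapes_step: "step M c d \<Longrightarrow> length (snd c) = tape_count M \<Longrightarrow> length (snd d) = tape_count M"
  using wf by (auto simp: step_def wf_tm_def)

text \<open>At the first difference one string takes a step with index \<open>i\<close>, while the
  other reads a zero and takes its next step with an index of at least \<open>i + 1\<close>. Equal
  traces would give both steps the same successor, hence the same index. Equal lengths exclude a
  mere difference in padding.\<close>

lemma bit_trace_inj:
  "length v = length w \<Longrightarrow> bit_run T v (i, c) = Some s \<Longrightarrow> bit_run T w (i, c) = Some s' \<Longrightarrow>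
    bit_trace T v (i, c) = bit_trace T w (i, c) \<Longrightarrow> length (snd c) = tape_count M \<Longrightarrow> v = w"
proof (induction v w arbitrary: i c rule: list_induct2)
  case (Cons a v b w)
  have neq: False
    if t: "bit_run T (True # v) (i, c) = Some s" "bit_run T (False # w) (i, c) = Some s'"
      "bit_trace T (True # v) (i, c) = bit_trace T (False # w) (i, c)" for v w s s'
  proof -
    obtain j d where d: "bit_step T True (i, c) = Some (j, d)"
      using t(1) by (cases "bit_step T True (i, c)") auto
    then have "j = 0" "i < length T"
      using bit_step_True by auto
    have "bit_run T w (Suc i, c) = Some s'" "bit_trace T w (Suc i, c) = d # bit_trace T v (j, d)"
      using that d \<open>i < length T\<close> by (auto simp: min_def split: if_splits)
    then obtain k where "Suc i \<le> k" "bit_step T True (k, c) = Some (0, d)"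
      using bit_trace_first by blast
    then show False
      using bit_step_True_inj[of i c d k] d \<open>j = 0\<close> Cons.prems by simp
  qed
  show ?case
  proof (cases "a = b")
    case True
    obtain i' c' where s: "bit_step T a (i, c) = Some (i', c')"
      using Cons.prems by (auto split: option.splits)
    moreover have "length (snd c') = tape_count M"
    proof (cases a)
      case True
      then show ?thesis
        using s bit_step_True[of i c i' c'] length_tapes_step[of c c'] Cons.prems by auto
    next
      case False
      then show ?thesis
        using s Cons.prems by auto
    qed
    ultimately have "v = w"
      using Cons.IH[of i' c'] Cons.prems True by (auto split: if_splits)
    then show ?thesis
      using True by simp
  next
    case False
    then show ?thesis
      using neq[of v s w s'] neq[of w s' v s] Cons.prems by (cases a; cases b) (simp_all del: bit_run.simps bit_trace.simps)
  qed
qed simp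

lemma bit_accepts_unique:
  assumes "\<And>cs ds. accepting_path M x cs \<Longrightarrow> accepting_path M x ds \<Longrightarrow> cs = ds"
    and "bit_accepts M T x v" "bit_accepts M T x w" "length v = length w"
  shows "v = w"
proof -
  have "bit_trace T v (0, init_config M x) = bit_trace T w (0, init_config M x)"
    using assms(1)[OF bit_accepts_path bit_accepts_path] assms(2,3) by blast
  moreover have "length (snd (init_config M x)) = tape_count M"
    using wf by (simp add: init_config_eq wf_tm_def)
  ultimately show ?thesis
    using assms(2-4) bit_trace_inj unfolding bit_accepts_def by blast
qed

text \<open>Each 1 performs a step, so \<open>n\<close> ones describe a run of \<open>n\<close>
  steps. Beyond the time bound this is impossible, which keeps the query outside
  \<open>blocks\<close>.\<close>

lemma bit_accepts_replicate_True:
  assumes "bit_accepts M T x (replicate n True)"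
  shows "\<exists>d. (step M ^^ n) (init_config M x) d"
proof -
  have "bit_run T (replicate n True) (i, c) = Some s \<Longrightarrow> (step M ^^ n) c (snd s)" for i c s
  proof (induction n arbitrary: i c)
    case (Suc n)
    then obtain j d where "bit_step T True (i, c) = Some (j, d)"
      "bit_run T (replicate n True) (j, d) = Some s"
      by (auto split: option.splits)
    then show ?case
      using Suc.IH bit_step_True by (meson relpowp_Suc_I2)
  qed auto
  then show ?thesis
    using assms unfolding bit_accepts_def by blast
qed

end


section \<open>The set of witness blocks\<close>

text \<open>A self-delimiting code: 1 announces another bit, and the 0 that \<open>block\<close>
  appends ends the list. Tags agree at equal positions, so comparing two codes of equal length
  compares the coded strings.\<close>

fun tagged :: "str \<Rightarrow> str" where
  "tagged [] = []"
| "tagged (a # x) = True # a # tagged x"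

definition block :: "str \<Rightarrow> bool \<Rightarrow> bool \<Rightarrow> str \<Rightarrow> str" where
  "block x c b w = tagged x @ False # c # b # w"

lemma length_tagged [simp]: "length (tagged x) = 2 * length x"
  by (induction x) auto

lemma length_block: "length (block x c b w) = 2 * length x + 3 + length w"
  by (simp add: block_def)

lemma tagged_append [simp]: "tagged (x @ y) = tagged x @ tagged y"
  by (induction x) auto

lemma tagged_delimited: "tagged x @ False # u = tagged y @ False # v \<longleftrightarrow> x = y \<and> u = v"
  by (induction x y rule: list_induct2') auto

lemma block_inject [simp]: "block x c b w = block x' c' b' w' \<longleftrightarrow> x = x' \<and> c = c' \<and> b = b' \<and> w = w'"
  unfolding block_def by (simp add: tagged_delimited)

text \<open>A shorter \<open>x\<close> gives a shorter block because \<open>G\<close> is monotone.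
  For equal lengths all tags agree, and the first difference within \<open>x\<close>, or else
  \<open>c\<close>, decides before \<open>b\<close> and \<open>w\<close> are reached. Membership in
  \<open>blocks\<close> is not assumed, so queries are covered too.\<close>

lemma block_less:
  assumes "str_less (x @ [c]) (x' @ [c'])" "length w = G (length x)" "length w' = G (length x')" "mono G"
  shows "str_less (block x c b w) (block x' c' b' w')"
proof (cases "length x = length x'")
  case True
  show ?thesis
  proof (cases "x = x'")
    case True
    then have "\<not> c" "c'"
      using assms(1) by (auto simp: str_less_snoc)
    then have "block x c b w = (tagged x @ [False]) @ False # b # w"
      "block x' c' b' w' = (tagged x @ [False]) @ True # b' # w'"
      using True by (auto simp: block_def)
    moreover have "length (block x c b w) = length (block x' c' b' w')"
      using True assms by (simp add: length_block)
    ultimately show ?thesis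
      unfolding str_less_iff by blast
  next
    case False
    then obtain p u v where "x = p @ False # u" "x' = p @ True # v"
      using assms(1) True str_less_iff[of x x'] by (auto simp: str_less_snoc)
    then have "block x c b w = (tagged p @ [True]) @ False # tagged u @ False # c # b # w"
      "block x' c' b' w' = (tagged p @ [True]) @ True # tagged v @ False # c' # b' # w'"
      by (auto simp: block_def)
    moreover have "length (block x c b w) = length (block x' c' b' w')"
      using True assms by (simp add: length_block)
    ultimately show ?thesis
      unfolding str_less_iff by blast
  qed
next
  case False
  then have "length x < length x'"
    using assms(1) by (auto simp: str_less_iff)
  then have "length w \<le> length w'"
    using assms(2-4) by (simp add: monoD)
  then show ?thesis
    using \<open>length x < length x'\<close> by (simp add: str_less_iff length_block)
qed

text \<open>In \<open>time\<close>, the bound on \<open>length (T b) * t\<close> leaves room to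
  spell out every run, and \<open>t < G (length x)\<close> makes the all-ones string of the padded
  length too long for any run.\<close>

locale witness_blocks =
  fixes M :: "bool \<Rightarrow> tm" and T :: "bool \<Rightarrow> transition list" and G :: "nat \<Rightarrow> nat"
  assumes choice_list: "choice_list (M b) (T b)"
    and compl: "language (M True) = - language (M False)"
    and unambiguous: "accepting_path (M b) x cs \<Longrightarrow> accepting_path (M b) x ds \<Longrightarrow> cs = ds"
    and mono: "mono G"
    and time: "(step (M b) ^^ t) (init_config (M b) x) d \<Longrightarrow> length (T b) * t \<le> G (length x) \<and> t < G (length x)"
begin

definition blocks :: "str set" where
  "blocks = {block x c b w | x c b w. length w = G (length x) \<and> bit_accepts (M b) (T b) x w}"

lemma block_in_blocks:
  "block x c b w \<in> blocks \<longleftrightarrow> length w = G (length x) \<and> bit_accepts (M b) (T b) x w"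
  by (auto simp: blocks_def)

text \<open>Exactly one of the two machines accepts \<open>x\<close>, which fixes \<open>b\<close>;
  its only accepting path has only one description of the prescribed length, which fixes
  \<open>w\<close>.\<close>

lemma witness_ex1: "\<exists>!(b, w). length w = G (length x) \<and> bit_accepts (M b) (T b) x w"
proof -
  obtain b where b: "x \<in> language (M b)"
    using compl by blast
  obtain w where w: "length w = G (length x)" "bit_accepts (M b) (T b) x w"
    using choice_list.bit_accepts_exists[OF choice_list b] time by blast
  have "b' = b \<and> w' = w" if "length w' = G (length x)" "bit_accepts (M b') (T b') x w'" for b' w'
  proof -
    have "x \<in> language (M b')"
      using choice_list.bit_accepts_language[OF choice_list] that by blast
    then have "b' = b"
      using b compl by (cases b; cases b') auto
    then show ?thesis
      using choice_list.bit_accepts_unique[OF choice_list unambiguous, where v = w' and w = w] w that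
      by auto
  qed
  then show ?thesis
    using w by (intro ex1I[of _ "(b, w)"]) (clarify, blast)+
qed

section \<open>Order-preserving enumeration of the blocks by nonempty strings\<close>

definition witness_block :: "str \<Rightarrow> str" where
  "witness_block v = (THE z. \<exists>b w. z = block (butlast v) (last v) b w \<and> z \<in> blocks)"

lemma witness_blockI:
  assumes "block x c b w \<in> blocks"
  shows "witness_block (x @ [c]) = block x c b w"
  unfolding witness_block_def
proof (rule the_equality)
  fix z
  assume "\<exists>b w. z = block (butlast (x @ [c])) (last (x @ [c])) b w \<and> z \<in> blocks"
  then obtain b' w' where z: "z = block x c b' w'" "block x c b' w' \<in> blocks"
    by auto
  then have "(b', w') = (b, w)"
    using assms witness_ex1[of x] unfolding block_in_blocks by blast
  then show "z = block x c b w"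
    using z by simp
qed (use assms in auto)

lemma witness_blockE:
  obtains b w where "witness_block (x @ [c]) = block x c b w" "block x c b w \<in> blocks"
proof -
  obtain b w where "length w = G (length x)" "bit_accepts (M b) (T b) x w"
    using witness_ex1[of x] by auto
  then have "block x c b w \<in> blocks"
    by (simp add: block_in_blocks)
  then show thesis
    using that witness_blockI by blast
qed

lemma blocks_eq: "blocks = witness_block ` {v. v \<noteq> []}"
proof (intro equalityI subsetI)
  fix z
  assume "z \<in> blocks"
  then obtain x c b w where z: "z = block x c b w"
    by (auto simp: blocks_def)
  then have "z = witness_block (x @ [c])"
    using witness_blockI \<open>z \<in> blocks\<close> by simp
  then show "z \<in> witness_block ` {v. v \<noteq> []}"
    by blast
next
  fix z
  assume "z \<in> witness_block ` {v. v \<noteq> []}"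
  then obtain x c where "z = witness_block (x @ [c])"
    by (auto simp: image_iff) (metis append_butlast_last_id)
  then show "z \<in> blocks"
    by (metis witness_blockE)
qed

lemma witness_block_less_block:
  assumes "str_less v (x @ [c])" "v \<noteq> []" "length w = G (length x)"
  shows "str_less (witness_block v) (block x c b w)"
proof -
  obtain x' c' where v: "v = x' @ [c']"
    using assms(2) by (metis append_butlast_last_id)
  obtain b' w' where "witness_block v = block x' c' b' w'" "block x' c' b' w' \<in> blocks"
    using witness_blockE v by metis
  then show ?thesis
    using block_less[of x' c' x c w' G w] assms v mono by (simp add: block_in_blocks)
qed

lemma block_less_witness_block:
  assumes "str_less (x @ [c]) v" "v \<noteq> []" "length w = G (length x)"
  shows "str_less (block x c b w) (witness_block v)"
proof -
  obtain x' c' where v: "v = x' @ [c']"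
    using assms(2) by (metis append_butlast_last_id)
  obtain b' w' where "witness_block v = block x' c' b' w'" "block x' c' b' w' \<in> blocks"
    using witness_blockE v by metis
  then show ?thesis
    using block_less[of x c x' c' w G w'] assms v mono by (simp add: block_in_blocks)
qed

lemma witness_block_mono:
  assumes "str_less v v'" "v \<noteq> []" "v' \<noteq> []"
  shows "str_less (witness_block v) (witness_block v')"
proof -
  obtain x' c' where v: "v' = x' @ [c']"
    using assms(3) by (metis append_butlast_last_id)
  obtain b' w' where "witness_block v' = block x' c' b' w'" "block x' c' b' w' \<in> blocks"
    using witness_blockE v by metis
  then show ?thesis
    using witness_block_less_block[of v x' c' w' b'] assms v by (simp add: block_in_blocks)
qed

lemma inj_witness_block: "inj_on witness_block {v. v \<noteq> []}"
  by (rule inj_onI) (metis mem_Collect_eq str_less_irrefl str_less_linear witness_block_mono)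

text \<open>The empty string precedes \<open>v\<close> but indexes no block, whence the subtraction
  of 1.\<close>

lemma card_witness_block:
  assumes "v \<noteq> []"
  shows "card (witness_block ` {u. u \<noteq> [] \<and> str_less u v}) = num_of_str v - 1"
proof -
  have "inj_on witness_block {u. u \<noteq> [] \<and> str_less u v}"
    by (rule inj_on_subset[OF inj_witness_block]) auto
  then have "card (witness_block ` {u. u \<noteq> [] \<and> str_less u v}) = card {u. u \<noteq> [] \<and> str_less u v}"
    by (rule card_image)
  also have "\<dots> = card ({u. str_less u v} - {[]})"
    by (rule arg_cong[where f = card]) auto
  also have "\<dots> = num_of_str v - 1"
    unfolding num_of_str_def using assms finite_str_less[of v]
    by (subst card_Diff_singleton) (auto simp: str_less_iff)
  finally show ?thesis .
qed

lemma num_of_str_pos: "v \<noteq> [] \<Longrightarrow> num_of_str v > 0"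
  using num_of_str_mono[of "[]" v] by (simp add: str_less_iff)


text \<open>Witness blocks of strings below \<open>xc\<close> lie below every block of
  \<open>(x, c)\<close> with padded \<open>w\<close>, and those of strings above \<open>xc\<close>
  lie above it. Only the position of the witness block of \<open>xc\<close> itself is open.\<close>

lemma rank_in_blocks:
  assumes "length w = G (length x)"
  shows "rank_in blocks (block x c b w) = num_of_str (x @ [c]) - 1 +
    (if str_le (witness_block (x @ [c])) (block x c b w) then 1 else 0)"
proof -
  let ?v = "x @ [c]" and ?y = "block x c b w"
  let ?B = "if str_le (witness_block ?v) ?y then {witness_block ?v} else {}"
  have le: "str_le (witness_block u) ?y \<longleftrightarrow>
      str_less u ?v \<or> u = ?v \<and> str_le (witness_block ?v) ?y" if "u \<noteq> []" for u
  proof -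
    have "str_less u ?v \<or> u = ?v \<or> str_less ?v u"
      by (rule str_less_linear)
    moreover have "str_le (witness_block u) ?y" if "str_less u ?v"
      using witness_block_less_block[OF that \<open>u \<noteq> []\<close> assms] by (simp add: str_le_def)
    moreover have "\<not> str_le (witness_block u) ?y \<and> \<not> str_less u ?v \<and> u \<noteq> ?v" if "str_less ?v u"
      using block_less_witness_block[OF that \<open>u \<noteq> []\<close> assms] str_less_trans that str_less_irrefl
      unfolding str_le_def by metis
    ultimately show ?thesis
      by blast
  qed
  have "{z. str_le z ?y \<and> z \<in> blocks} = witness_block ` {u. u \<noteq> [] \<and> str_less u ?v} \<union> ?B"
  proof (intro set_eqI iffI)
    fix z
    assume "z \<in> {z. str_le z ?y \<and> z \<in> blocks}"
    then obtain u where "u \<noteq> []" "z = witness_block u" "str_le z ?y"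
      by (auto simp: blocks_eq)
    then show "z \<in> witness_block ` {u. u \<noteq> [] \<and> str_less u ?v} \<union> ?B"
      using le[of u] by (cases "u = ?v") simp_all
  next
    fix z
    assume "z \<in> witness_block ` {u. u \<noteq> [] \<and> str_less u ?v} \<union> ?B"
    then obtain u where "u \<noteq> []" "z = witness_block u" "str_less u ?v \<or> u = ?v \<and> str_le z ?y"
      by (auto split: if_splits)
    then show "z \<in> {z. str_le z ?y \<and> z \<in> blocks}"
      using le[of u] by (auto simp: blocks_eq)
  qed
  moreover have "witness_block ?v \<notin> witness_block ` {u. u \<noteq> [] \<and> str_less u ?v}"
    using inj_witness_block by (auto dest!: inj_onD)
  ultimately show ?thesis
    unfolding rank_in_def card_witness_block[OF snoc_eq_iff_butlast[THEN iffD1, THEN conjunct1, OF refl], symmetric]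
    using finite_str_less[of ?v] by auto
qed

text \<open>The member itself compensates for the missing empty string. Hence the ranking function
  has to output just \<open>1xc\<close>, a copy of parts of the input.\<close>

lemma rank_in_blocks_member:
  assumes "block x c b w \<in> blocks"
  shows "rank_in blocks (block x c b w) = num_of_str (x @ [c])"
  using assms rank_in_blocks[of w x c b] witness_blockI[OF assms] num_of_str_pos[of "x @ [c]"]
  by (simp add: block_in_blocks str_le_def)

section \<open>The query and the parity of its rank\<close>

definition query :: "str \<Rightarrow> str" where
  "query x = block x False False (replicate (G (length x)) True)"

lemma query_notin_blocks: "query x \<notin> blocks"
proof
  assume "query x \<in> blocks"
  then have "bit_accepts (M False) (T False) x (replicate (G (length x)) True)"
    by (simp add: query_def block_in_blocks)
  then obtain d where "(step (M False) ^^ G (length x)) (init_config (M False) x) d"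
    using choice_list.bit_accepts_replicate_True[OF choice_list] by blast
  then show False
    using time by blast
qed

text \<open>If \<open>b\<close> is 0, the witness differs from the query only in \<open>w\<close>,
  and no string of that length exceeds the all-ones string. If \<open>b\<close> is 1, the bit
  \<open>b\<close> already puts the witness above the query.\<close>

lemma witness_block_le_query:
  "str_le (witness_block (x @ [False])) (query x) \<longleftrightarrow> x \<in> language (M False)"
proof -
  obtain b w where w: "witness_block (x @ [False]) = block x False b w" "block x False b w \<in> blocks"
    using witness_blockE by blast
  then have len: "length w = G (length x)" and acc: "bit_accepts (M b) (T b) x w"
    by (auto simp: block_in_blocks)
  have "x \<in> language (M b)"
    using choice_list.bit_accepts_language[OF choice_list acc] .
  then have lang: "x \<in> language (M False) \<longleftrightarrow> \<not> b"
    using compl by (cases b) auto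
  have all_True: "\<not> str_less (replicate n True) u" if u: "length u = n" for n u
  proof
    assume "str_less (replicate n True) u"
    then obtain p v where "replicate n True = p @ False # v"
      using u by (auto simp: str_less_iff)
    then have "False \<in> set (replicate n True)"
      by simp
    then show False
      by simp
  qed
  show ?thesis
  proof (cases b)
    case True
    let ?p = "tagged x @ [False, False]"
    have "query x = ?p @ False # replicate (G (length x)) True" "witness_block (x @ [False]) = ?p @ True # w"
      using w(1) True by (auto simp: query_def block_def)
    then have "str_less (query x) (witness_block (x @ [False]))"
      using len unfolding str_less_iff by (metis length_append length_Cons length_replicate)
    then show ?thesis
      using lang True str_less_trans str_less_irrefl unfolding str_le_def by metis
  next
    case False
    have "str_less w (replicate (G (length x)) True) \<or> w = replicate (G (length x)) True"
      using str_less_linear all_True[OF len] by blast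
    then have "str_le (witness_block (x @ [False])) (query x)"
      using str_less_append_left[of w "replicate (G (length x)) True" "tagged x @ [False, False, False]"]
        w(1) False by (auto simp: query_def block_def str_le_def)
    then show ?thesis
      using lang False by simp
  qed
qed

text \<open>Since \<open>x0\<close> has number \<open>2 * num_of_str x + 1\<close>, the rank in
  \<open>blocks\<close> is \<open>2 * num_of_str x\<close>, plus 1 exactly when \<open>x\<close> is
  in the language. The two ranks add up to the successor of the even number of the query, so they
  have opposite parities.\<close>

lemma even_rank_in_compl_query: "even (rank_in (- blocks) (query x)) \<longleftrightarrow> x \<in> language (M False)"
proof -
  \<comment> \<open>The run of zero steps already forces \<open>0 < G (length x)\<close>, so the
    query really ends in 1.\<close>
  have "G (length x) \<noteq> 0"
    using time[of 0 False x "init_config (M False) x"] by auto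
  then obtain n where n: "G (length x) = Suc n"
    using not0_implies_Suc by blast
  then have "query x = (tagged x @ [False, False, False] @ replicate n True) @ [True]"
    by (simp add: query_def block_def replicate_append_same)
  then have "even (num_of_str (query x))"
    by (metis dvd_add_triv_right_iff dvd_triv_left num_of_str_snoc)
  moreover have "rank_in blocks (query x) = 2 * num_of_str x + (if x \<in> language (M False) then 1 else 0)"
    using rank_in_blocks[of "replicate (G (length x)) True" x False False]
    by (simp add: witness_block_le_query[unfolded query_def] query_def num_of_str_snoc)
  then have "even (rank_in blocks (query x)) \<longleftrightarrow> x \<notin> language (M False)"
    by simp
  ultimately show ?thesis
    using rank_in_compl[of blocks "query x"] by (metis even_Suc even_add)
qed

end


section \<open>Clocked machines\<close>

text \<open>The tapes are an input tape, \<open>K\<close> work tapes, \<open>C\<close> counter tapes, and an output tape.\<close>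

type_synonym action = "symbol \<times> move"

type_synonym 'q clocked_program = "'q \<Rightarrow> symbol \<Rightarrow> symbol list \<Rightarrow> symbol list \<Rightarrow> symbol \<Rightarrow>
  ('q \<times> action \<times> action list \<times> action list \<times> action) option"

definition layout :: "nat \<Rightarrow> nat \<Rightarrow> 'q clocked_program \<Rightarrow> 'q program" where
  "layout K C \<delta> q ss = map_option (\<lambda>(q', a, ns, cs, b). (q', a # ns @ cs @ [b]))
    (\<delta> q (hd ss) (take K (tl ss)) (take C (drop K (tl ss))) (last ss))"

abbreviation read :: "tape \<times> int \<Rightarrow> symbol" where
  "read p \<equiv> fst p (snd p)"

lemma layout_scanned:
  assumes "length ns = K" "length cs = C"
  shows "layout K C \<delta> q (scanned (z # ns @ cs @ [out])) =
    map_option (\<lambda>(q', a, ns, cs, b). (q', a # ns @ cs @ [b]))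
      (\<delta> q (read z) (scanned ns) (scanned cs) (read out))"
  using assms by (simp add: layout_def)

lemma runs_layout:
  assumes "\<delta> q (read z) (scanned ns) (scanned cs) (read out) = Some (q', a, nas, cas, b)"
    and "length ns = K" "length cs = C" "length nas = K" "length cas = C"
  shows "runs (layout K C \<delta>) 1 (q, z # ns @ cs @ [out])
    (q', act a z # map2 act nas ns @ map2 act cas cs @ [act b out])"
  by (rule runs_1) (use assms in \<open>auto simp: layout_scanned simp del: scanned_simps scanned_append\<close>)

lemma program_layout:
  assumes "finite Q" "finite \<Gamma>" "q\<^sub>0 \<in> Q" "{Blank, Bit False, Bit True} \<subseteq> \<Gamma>"
    and "\<And>q s ns cs out q' a nas cas b. q \<in> Q \<Longrightarrow> length ns = K \<Longrightarrow> length cs = C \<Longrightarrow>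
      s \<in> \<Gamma> \<Longrightarrow> set ns \<subseteq> \<Gamma> \<Longrightarrow> set cs \<subseteq> \<Gamma> \<Longrightarrow> out \<in> \<Gamma> \<Longrightarrow>
      \<delta> q s ns cs out = Some (q', a, nas, cas, b) \<Longrightarrow>
      q' \<in> Q \<and> length nas = K \<and> length cas = C \<and>
      fst a \<in> \<Gamma> \<and> fst ` set nas \<subseteq> \<Gamma> \<and> fst ` set cas \<subseteq> \<Gamma> \<and> fst b \<in> \<Gamma>"
  shows "program (K + C + 2) Q \<Gamma> (layout K C \<delta>) q\<^sub>0"
proof
  fix b
  show "Bit b \<in> \<Gamma>"
    using assms(4) by (cases b) auto
next
  fix q ss q' as
  assume q: "q \<in> Q" "length ss = K + C + 2" "set ss \<subseteq> \<Gamma>" "layout K C \<delta> q ss = Some (q', as)"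
  then obtain s ss' where "ss = s # ss'" "length ss' = K + C + 1"
    by (cases ss) auto
  moreover from this obtain us out where "ss' = us @ [out]" "length us = K + C"
    by (cases ss' rule: rev_cases) auto
  moreover define ns cs where "ns = take K us" and "cs = drop K us"
  ultimately have ss: "ss = s # ns @ cs @ [out]" "length ns = K" "length cs = C"
    by auto
  then obtain a nas cas b where "\<delta> q s ns cs out = Some (q', a, nas, cas, b)"
    "as = a # nas @ cas @ [b]"
    using q(4) by (auto simp: layout_def)
  then show "q' \<in> Q \<and> length as = K + C + 2 \<and> fst ` set as \<subseteq> \<Gamma>"
    using assms(5)[of q ns cs s out q' a nas cas b] q(1,3) ss by (auto simp: image_Un)
qed (use assms in auto)

definition writer :: "str \<Rightarrow> tape \<times> int" where
  "writer u = (str_tape u, int (length u))"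

lemma write_bit [simp]: "act (Bit a, Right) (writer u) = writer (u @ [a])"
  by (auto simp: writer_def str_tape_def fun_eq_iff nth_append)

lemma fst_writer [simp]: "fst (writer u) = str_tape u"
  by (simp add: writer_def)

lemma read_writer [simp]: "str_tape u (snd (writer u)) = Blank"
  by (simp add: writer_def str_tape_def)

lemma act_stay [simp]: "act (read p, Stay) p = p"
  by (cases p) simp

lemma start_tapes_layout:
  "start_tapes (K + C + 2) x = (str_tape x, 0) # replicate K (writer []) @ replicate C (writer []) @ [writer []]"
  by (simp add: start_tapes_def writer_def replicate_add replicate_append_same replicate_app_Cons_same)


subsection \<open>The clock\<close>

text \<open>A counter tape has \<open>m\<close> marked cells \<open>0, \<dots>, m - 1\<close> surrounded by blanks, between which its head
  sweeps back and forth. A counter is represented by the direction of its head (rightwards if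
  \<open>True\<close>) and by the number of moves left until the head reaches the blank cell ahead, where it
  turns and passes a carry to the next counter.\<close>

definition counter_tape :: "nat \<Rightarrow> tape" where
  "counter_tape m i = (if 0 \<le> i \<and> i < int m then Aux 0 else Blank)"

fun counter :: "nat \<Rightarrow> bool \<times> nat \<Rightarrow> tape \<times> int" where
  "counter m (d, r) = (counter_tape m, if d then int m - int r else int r - 1)"

text \<open>A counter tape while its marks are still being laid, in step with the reading of
  \<open>x\<close>. By \<open>turn_marker\<close> one move to the left makes it a counter with all
  its moves left.\<close>

definition marker :: "nat \<Rightarrow> tape \<times> int" where
  "marker k = (counter_tape k, int k)"

lemma marker_0: "writer [] = marker 0"
  by (auto simp: marker_def writer_def counter_tape_def)

lemma read_marker [simp]: "read (marker k) = Blank"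
  by (simp add: marker_def counter_tape_def)

lemma act_marker [simp]: "act (Aux 0, Right) (marker k) = marker (Suc k)"
  by (auto simp: marker_def counter_tape_def)

lemma turn_marker [simp]: "act (Blank, Left) (marker k) = counter k (False, k)"
  by (auto simp: marker_def counter_tape_def)

lemma read_counter: "r \<le> m \<Longrightarrow> read (counter m (d, r)) = (if r = 0 then Blank else Aux 0)"
  by (auto simp: counter_tape_def)

fun direction :: "bool \<Rightarrow> move" where
  "direction True = Right"
| "direction False = Left"

text \<open>The finite control stores only the directions, as the number of moves left is implicit
  in the head position. A blank means that no move is left: this head turns, and the next counter
  moves as well.\<close>

fun tick_actions :: "bool list \<Rightarrow> symbol list \<Rightarrow> bool list \<times> action list" where
  "tick_actions (d # ds) (s # ss) = (if s = Blank
    then (case tick_actions ds ss of (ds', as) \<Rightarrow> ((\<not> d) # ds', (s, direction (\<not> d)) # as))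
    else (d # ds, (s, direction d) # stay ss))"
| "tick_actions _ _ = ([], [])"

fun tick :: "nat \<Rightarrow> (bool \<times> nat) list \<Rightarrow> (bool \<times> nat) list" where
  "tick m [] = []"
| "tick m ((d, r) # cs) = (if r = 0 then (\<not> d, m) # tick m cs else (d, r - 1) # cs)"

text \<open>The counters are the digits, least significant first, of a number in base
  \<open>m + 1\<close>; as long as it is positive, \<open>tick\<close> subtracts 1, with
  borrow.\<close>

fun time_left :: "nat \<Rightarrow> (bool \<times> nat) list \<Rightarrow> nat" where
  "time_left m [] = 0"
| "time_left m ((d, r) # cs) = r + Suc m * time_left m cs"

definition clock :: "nat \<Rightarrow> nat \<Rightarrow> (bool \<times> nat) list \<Rightarrow> bool" where
  "clock C m cs \<longleftrightarrow> length cs = C \<and> (\<forall>(d, r) \<in> set cs. r \<le> m)"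

lemma tick_actions_closed:
  "length ds = length ss \<Longrightarrow> tick_actions ds ss = (ds', as) \<Longrightarrow>
    length ds' = length ss \<and> length as = length ss \<and> fst ` set as = set ss"
  by (induction ds ss arbitrary: ds' as rule: tick_actions.induct) (auto split: if_splits prod.splits)

lemma tick_actions_counters:
  "\<forall>(d, r) \<in> set cs. r \<le> m \<Longrightarrow>
    tick_actions (map fst cs) (scanned (map (counter m) cs)) = (ds, as) \<Longrightarrow>
    ds = map fst (tick m cs) \<and> map2 act as (map (counter m) cs) = map (counter m) (tick m cs)"
proof (induction cs arbitrary: ds as)
  case (Cons p cs)
  obtain d r where p: "p = (d, r)"
    by fastforce
  obtain ds' as' where t: "tick_actions (map fst cs) (scanned (map (counter m) cs)) = (ds', as')"
    by fastforce
  have r: "r \<le> m"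
    using Cons.prems p by auto
  show ?case
  proof (cases "r = 0")
    case True
    then have "(counter m (d, r)) = (counter_tape m, if d then int m else - 1)"
      by simp
    moreover have "counter_tape m (if d then int m else - 1) = Blank"
      by (simp add: counter_tape_def)
    ultimately show ?thesis
      using Cons.IH[OF _ t] Cons.prems t True p
      by (cases d) (auto simp: fun_eq_iff)
  next
    case False
    then have "counter_tape m (snd (counter m (d, r))) = Aux 0"
      using r by (simp add: counter_tape_def)
    then show ?thesis
      using Cons.prems p False by (cases d) (auto simp: fun_eq_iff of_nat_diff)
  qed
qed simp

lemma tick_clock: "clock C m cs \<Longrightarrow> clock C m (tick m cs)"
proof -
  have "length (tick m cs) = length cs" for cs
    by (induction m cs rule: tick.induct) auto
  moreover have "\<forall>(d, r) \<in> set cs. r \<le> m \<Longrightarrow> \<forall>(d, r) \<in> set (tick m cs). r \<le> m" for cs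
    by (induction m cs rule: tick.induct) auto
  ultimately show "clock C m cs \<Longrightarrow> clock C m (tick m cs)"
    unfolding clock_def by blast
qed

lemma time_left_tick: "time_left m cs > 0 \<Longrightarrow> time_left m cs = Suc (time_left m (tick m cs))"
  by (induction m cs rule: tick.induct) (auto simp: algebra_simps)

text \<open>A head scans a blank exactly when its counter has no move left, so a finite control can
  see that the time is up.\<close>

lemma time_left_0_iff:
  "clock C m cs \<Longrightarrow> time_left m cs = 0 \<longleftrightarrow> set (scanned (map (counter m) cs)) \<subseteq> {Blank}"
  unfolding clock_def
proof (induction cs arbitrary: C)
  case (Cons p cs)
  obtain d r where p: "p = (d, r)"
    by fastforce
  then show ?case
    using Cons.IH[of "C - 1"] Cons.prems read_counter[of r m d] by auto
qed simp

text \<open>The value of \<open>C\<close> maximal digits \<open>n + 1\<close> in base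
  \<open>n + 2\<close>. Using \<open>n + 1\<close> marks makes the base at least 2 even for empty
  input, so that large constants are dominated as well.\<close>

definition ticks :: "nat \<Rightarrow> nat \<Rightarrow> nat" where
  "ticks C n = (n + 2) ^ C - 1"

lemma time_left_start: "time_left (Suc n) (replicate C (d, Suc n)) = ticks C n"
proof -
  have "Suc (time_left m (replicate C (d, m))) = Suc m ^ C" for m
  proof (induction C)
    case (Suc C)
    show ?case
      by (simp add: algebra_simps flip: Suc.IH)
  qed simp
  from this[of "Suc n"] show ?thesis
    by (simp add: ticks_def)
qed

lemma clock_start: "clock C m (replicate C (d, m))"
  by (auto simp: clock_def)

lemma mono_ticks: "mono (ticks C)"
  by (auto simp: mono_def ticks_def intro!: diff_le_mono power_mono)

lemma ticks_dominates: "\<exists>C. \<forall>n. poly p n \<le> ticks C n"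
proof -
  have "\<exists>k. \<forall>n. Suc (poly p n) \<le> (n + 2) ^ k"
  proof (induction p)
    case 0
    show ?case
      by (intro exI[of _ 0]) simp
  next
    case (pCons a p)
    then obtain k where k: "\<And>n. Suc (poly p n) \<le> (n + 2) ^ k"
      by blast
    \<comment> \<open>The coefficient \<open>a\<close> is absorbed by \<open>a\<close> factors, as
      \<open>a + 1 \<le> 2 ^ a \<le> (n + 2) ^ a\<close>, and the multiplication by \<open>n\<close>
      by one more factor.\<close>
    have "Suc (poly (pCons a p) n) \<le> (n + 2) ^ (a + k + 1)" for n
    proof -
      have "a < 2 ^ a"
        by (rule less_exp)
      also have "(2 :: nat) ^ a \<le> (n + 2) ^ a"
        by (rule power_mono) auto
      finally have a: "a + 1 \<le> (n + 2) ^ a"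
        by simp
      have "Suc (poly (pCons a p) n) \<le> (a + 1) * ((n + 2) * Suc (poly p n))"
        by (simp add: algebra_simps)
      also have "\<dots> \<le> (n + 2) ^ a * ((n + 2) * (n + 2) ^ k)"
        using a k by (intro mult_le_mono) auto
      finally show ?thesis
        by (simp add: power_add algebra_simps)
    qed
    then show ?case
      by blast
  qed
  then show ?thesis
    unfolding ticks_def by (metis Suc_le_D diff_Suc_1 diff_le_mono plus_1_eq_Suc le_add1 add_diff_cancel_left')
qed


section \<open>Computing the queries\<close>

datatype query_state = Query_Start | Query_Tag | Query_Bit | Query_Sep1 | Query_Sep2 | Query_Pad "bool list"

text \<open>One mark is laid before any input is read, so \<open>length x + 1\<close> marks result.
  The two separator states write the bits \<open>c\<close> and \<open>b\<close>; afterwards each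
  tick writes a 1, so the clock fixes the number of ones.\<close>

fun query_program :: "nat \<Rightarrow> query_state clocked_program" where
  "query_program C Query_Start s ns cs out =
    Some (Query_Tag, (s, Stay), [], replicate C (Aux 0, Right), (out, Stay))"
| "query_program C Query_Tag (Bit a) ns cs out =
    Some (Query_Bit, (Bit a, Stay), [], stay cs, (Bit True, Right))"
| "query_program C Query_Tag s ns cs out =
    Some (Query_Sep1, (s, Stay), [], replicate C (Blank, Left), (Bit False, Right))"
| "query_program C Query_Bit (Bit a) ns cs out =
    Some (Query_Tag, (Bit a, Right), [], replicate C (Aux 0, Right), (Bit a, Right))"
| "query_program C Query_Bit s ns cs out = None"
| "query_program C Query_Sep1 s ns cs out =
    Some (Query_Sep2, (s, Stay), [], stay cs, (Bit False, Right))"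
| "query_program C Query_Sep2 s ns cs out =
    Some (Query_Pad (replicate C False), (s, Stay), [], stay cs, (Bit False, Right))"
| "query_program C (Query_Pad ds) s ns cs out = (if set cs \<subseteq> {Blank} then None else
    case tick_actions ds cs of (ds', as) \<Rightarrow> Some (Query_Pad ds', (s, Stay), [], as, (Bit True, Right)))"

lemma program_query:
  "program (0 + C + 2) ({Query_Start, Query_Tag, Query_Bit, Query_Sep1, Query_Sep2} \<union>
      Query_Pad ` {ds. set ds \<subseteq> UNIV \<and> length ds = C})
    {Blank, Bit False, Bit True, Aux 0} (layout 0 C (query_program C)) Query_Start"
  (is "program _ ?Q ?\<Gamma> _ _")
proof (rule program_layout)
  show "finite ?Q"
    using finite_lists_length_eq[of "UNIV :: bool set" C] by simp
next
  fix q s ns cs out q' a nas cas b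
  assume h: "q \<in> ?Q" "length ns = 0" "length cs = C" "s \<in> ?\<Gamma>" "set ns \<subseteq> ?\<Gamma>" "set cs \<subseteq> ?\<Gamma>" "out \<in> ?\<Gamma>"
    "query_program C q s ns cs out = Some (q', a, nas, cas, b)"
  have bit: "Bit c \<in> ?\<Gamma>" for c
    by (cases c) auto
  show "q' \<in> ?Q \<and> length nas = 0 \<and> length cas = C \<and>
      fst a \<in> ?\<Gamma> \<and> fst ` set nas \<subseteq> ?\<Gamma> \<and> fst ` set cas \<subseteq> ?\<Gamma> \<and> fst b \<in> ?\<Gamma>"
  proof (cases "\<exists>ds. q = Query_Pad ds")
    case True
    then obtain ds where ds: "q = Query_Pad ds" "length ds = C"
      using h(1) by auto
    then have t: "tick_actions ds cs = (fst (tick_actions ds cs), cas)" "nas = []" "a = (s, Stay)"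
      "b = (Bit True, Right)" "q' = Query_Pad (fst (tick_actions ds cs))"
      using h(8) by (auto split: if_splits prod.splits)
    then show ?thesis
      using tick_actions_closed[OF _ t(1)] ds(2) h by auto
  next
    case False
    then show ?thesis
      using h bit by (cases "(C, q, s, ns, cs, out)" rule: query_program.cases) (auto split: if_splits)
  qed
qed auto

lemma runs_query_copy:
  assumes "x = u @ v"
  shows "runs (layout 0 C (query_program C)) (2 * length v)
    (Query_Tag, (str_tape x, int (length u)) # [] @ replicate C (marker (Suc (length u))) @ [writer (tagged u)])
    (Query_Tag, (str_tape x, int (length x)) # [] @ replicate C (marker (Suc (length x))) @ [writer (tagged x)])"
  using assms
proof (induction v arbitrary: u)
  case Nil
  then show ?case
    by (simp add: runs_0)
next
  case (Cons a v)
  let ?\<delta> = "layout 0 C (query_program C)"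
  have s: "str_tape x (int (length u)) = Bit a"
    using Cons.prems by (simp add: str_tape_def)
  have "runs ?\<delta> 1
    (Query_Tag, (str_tape x, int (length u)) # [] @ replicate C (marker (Suc (length u))) @ [writer (tagged u)])
    (Query_Bit, (str_tape x, int (length u)) # [] @ replicate C (marker (Suc (length u))) @ [writer (tagged u @ [True])])"
    using runs_layout[of "query_program C" Query_Tag "(str_tape x, int (length u))" "[]"
        "replicate C (marker (Suc (length u)))" "writer (tagged u)"] s
    by (simp add: fun_upd_idem)
  moreover have "runs ?\<delta> 1
    (Query_Bit, (str_tape x, int (length u)) # [] @ replicate C (marker (Suc (length u))) @ [writer (tagged u @ [True])])
    (Query_Tag, (str_tape x, int (length (u @ [a]))) # [] @ replicate C (marker (Suc (length (u @ [a])))) @ [writer (tagged (u @ [a]))])"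
    using runs_layout[of "query_program C" Query_Bit "(str_tape x, int (length u))" "[]"
        "replicate C (marker (Suc (length u)))" "writer (tagged u @ [True])"] s
    by (simp add: fun_upd_idem add.commute)
  moreover have "runs ?\<delta> (2 * length v)
    (Query_Tag, (str_tape x, int (length (u @ [a]))) # [] @ replicate C (marker (Suc (length (u @ [a])))) @ [writer (tagged (u @ [a]))])
    (Query_Tag, (str_tape x, int (length x)) # [] @ replicate C (marker (Suc (length x))) @ [writer (tagged x)])"
    using Cons.IH[of "u @ [a]"] Cons.prems by simp
  ultimately show ?case
    by (auto dest: runs_trans)
qed

lemma runs_query_pad:
  assumes "clock C m cs"
  shows "\<exists>cs'. clock C m cs' \<and> time_left m cs' = 0 \<and>
    runs (layout 0 C (query_program C)) (time_left m cs)
      (Query_Pad (map fst cs), z # [] @ map (counter m) cs @ [writer u])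
      (Query_Pad (map fst cs'), z # [] @ map (counter m) cs' @ [writer (u @ replicate (time_left m cs) True)])"
  using assms
proof (induction "time_left m cs" arbitrary: cs u)
  case 0
  then show ?case
    by (intro exI[of _ cs]) (auto simp: runs_0)
next
  case (Suc n)
  let ?\<delta> = "layout 0 C (query_program C)"
  obtain ds as where t: "tick_actions (map fst cs) (scanned (map (counter m) cs)) = (ds, as)"
    by fastforce
  have len: "length cs = C" "\<forall>(d, r) \<in> set cs. r \<le> m"
    using Suc.prems by (auto simp: clock_def)
  have as: "length as = C"
    using tick_actions_closed[OF _ t] len by simp
  have n: "time_left m (tick m cs) = n"
    using time_left_tick[of m cs] Suc.hyps(2) by simp
  have "\<not> set (scanned (map (counter m) cs)) \<subseteq> {Blank}"
    using time_left_0_iff[OF Suc.prems] Suc.hyps(2) by simp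
  then have "query_program C (Query_Pad (map fst cs)) (read z) (scanned []) (scanned (map (counter m) cs))
      (read (writer u)) = Some (Query_Pad ds, (read z, Stay), [], as, (Bit True, Right))"
    using t by simp
  then have "runs ?\<delta> 1
    (Query_Pad (map fst cs), z # [] @ map (counter m) cs @ [writer u])
    (Query_Pad (map fst (tick m cs)), z # [] @ map (counter m) (tick m cs) @ [writer (u @ [True])])"
    using tick_actions_counters[OF len(2) t] len as
      runs_layout[of "query_program C" "Query_Pad (map fst cs)" z "[]" "map (counter m) cs" "writer u"
        "Query_Pad ds" "(read z, Stay)" "[]" as "(Bit True, Right)" 0 C] by simp
  moreover obtain cs' where "clock C m cs'" "time_left m cs' = 0" "runs ?\<delta> n
      (Query_Pad (map fst (tick m cs)), z # [] @ map (counter m) (tick m cs) @ [writer (u @ [True])])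
      (Query_Pad (map fst cs'), z # [] @ map (counter m) cs' @ [writer ((u @ [True]) @ replicate n True)])"
    using Suc.hyps(1)[of "tick m cs" "u @ [True]"] n tick_clock[OF Suc.prems] by auto
  ultimately show ?case
    using runs_trans[of ?\<delta> 1 _ _ n] Suc.hyps(2)[symmetric] by (intro exI[of _ cs']) auto
qed

lemma polytime_computable_query:
  "polytime_computable (\<lambda>x. block x False False (replicate (ticks C (length x)) True))"
proof (rule program.polytime_computableI[OF program_query[of C], of "[:4, 2:] + [:2, 1:] ^ C"])
  fix x :: str
  let ?\<delta> = "layout 0 C (query_program C)"
  let ?n = "length x"
  let ?m = "Suc ?n"
  let ?z = "(str_tape x, int ?n)"
  let ?cs = "replicate C (False, ?m)"
  have r1: "runs ?\<delta> 1 (Query_Start, start_tapes (0 + C + 2) x)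
    (Query_Tag, (str_tape x, int (length [])) # [] @ replicate C (marker (Suc (length []))) @ [writer (tagged [])])"
    using act_stay[of "marker 0"] runs_layout[of "query_program C" Query_Start "(str_tape x, 0)" "[]"
        "replicate C (marker 0)" "writer []"]
    unfolding start_tapes_layout by (simp add: marker_0 del: fst_writer)
  have r2: "runs ?\<delta> 1
    (Query_Tag, ?z # [] @ replicate C (marker ?m) @ [writer (tagged x)])
    (Query_Sep1, ?z # [] @ map (counter ?m) ?cs @ [writer (tagged x @ [False])])"
    using runs_layout[of "query_program C" Query_Tag ?z "[]" "replicate C (marker ?m)" "writer (tagged x)"]
    by (simp add: str_tape_def fun_upd_idem)
  have r3: "runs ?\<delta> 1
    (Query_Sep1, ?z # [] @ map (counter ?m) ?cs @ [writer (tagged x @ [False])])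
    (Query_Sep2, ?z # [] @ map (counter ?m) ?cs @ [writer (tagged x @ [False, False])])"
    using runs_layout[of "query_program C" Query_Sep1 ?z "[]" "map (counter ?m) ?cs" "writer (tagged x @ [False])"]
    by (simp del: map_replicate)
  have r4: "runs ?\<delta> 1
    (Query_Sep2, ?z # [] @ map (counter ?m) ?cs @ [writer (tagged x @ [False, False])])
    (Query_Pad (map fst ?cs), ?z # [] @ map (counter ?m) ?cs @ [writer (tagged x @ [False, False, False])])"
    using runs_layout[of "query_program C" Query_Sep2 ?z "[]" "map (counter ?m) ?cs" "writer (tagged x @ [False, False])"]
    by simp
  obtain cs' where cs': "clock C ?m cs'" "time_left ?m cs' = 0" "runs ?\<delta> (ticks C ?n)
      (Query_Pad (map fst ?cs), ?z # [] @ map (counter ?m) ?cs @ [writer (tagged x @ [False, False, False])])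
      (Query_Pad (map fst cs'), ?z # [] @ map (counter ?m) cs' @
        [writer ((tagged x @ [False, False, False]) @ replicate (ticks C ?n) True)])"
    using runs_query_pad[OF clock_start[of C ?m False], of ?z "tagged x @ [False, False, False]"]
    unfolding time_left_start by blast
  let ?ts = "?z # [] @ map (counter ?m) cs' @
        [writer ((tagged x @ [False, False, False]) @ replicate (ticks C ?n) True)]"
  have run: "runs ?\<delta> (1 + 2 * ?n + 1 + 1 + 1 + ticks C ?n) (Query_Start, start_tapes (0 + C + 2) x)
      (Query_Pad (map fst cs'), ?ts)"
    using runs_trans[OF runs_trans[OF runs_trans[OF runs_trans[OF runs_trans[OF
      r1 runs_query_copy[of x "[]" x]] r2] r3] r4] cs'(3)] by simp
  have "set (scanned (map (counter ?m) cs')) \<subseteq> {Blank}" "length cs' = C"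
    using cs' time_left_0_iff by (auto simp: clock_def)
  then have halt: "?\<delta> (Query_Pad (map fst cs')) (scanned ?ts) = None"
    by (subst layout_scanned) auto
  \<comment> \<open>Four single transitions, two steps per input bit, and fewer than
    \<open>(n + 2)^C\<close> ticks.\<close>
  have time: "1 + 2 * ?n + 1 + 1 + 1 + ticks C ?n \<le> poly ([:4, 2:] + [:2, 1:] ^ C) ?n"
    by (simp add: ticks_def poly_power algebra_simps)
  have out: "fst (last ?ts) = str_tape (block x False False (replicate (ticks C ?n) True))"
    by (simp add: block_def)
  show "\<exists>t q ts. runs ?\<delta> t (Query_Start, start_tapes (0 + C + 2) x) (q, ts) \<and>
      ?\<delta> q (scanned ts) = None \<and> t \<le> poly ([:4, 2:] + [:2, 1:] ^ C) ?n \<and>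
      fst (last ts) = str_tape (block x False False (replicate (ticks C ?n) True))"
    using run halt time out by blast
qed


section \<open>Recognizing and ranking the witness blocks\<close>

datatype verify_state = V_Start | V_Tag | V_Bit | V_Rewind | V_Sep1 | V_Sep2
  | V_Run bool nat nat "bool list" | V_Erase

locale clocked_witness_blocks = witness_blocks M T "ticks C"
  for M :: "bool \<Rightarrow> tm" and T :: "bool \<Rightarrow> transition list" and C :: nat
begin

definition K :: nat where
  "K = max (tape_count (M False)) (tape_count (M True))"

text \<open>The outer \<^const>\<open>None\<close> stands for rejection and \<open>Some None\<close> for halting. The output is written
  while the input is being read, and it is erased on rejection.\<close>

definition verify_run :: "bool \<Rightarrow> nat \<Rightarrow> nat \<Rightarrow> bool list \<Rightarrow> symbol \<Rightarrow> symbol list \<Rightarrow> symbol list \<Rightarrow>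
    symbol \<Rightarrow> (verify_state \<times> action \<times> action list \<times> action list \<times> action) option option" where
  "verify_run b q i ds s ns cs out =
    (let k = tape_count (M b) in case s of
      Bit w \<Rightarrow> if set cs \<subseteq> {Blank} then None
        else if \<not> w then Some (Some (V_Run b q (min (Suc i) (length (T b))) (fst (tick_actions ds cs)),
          (s, Right), stay ns, snd (tick_actions ds cs), (out, Stay)))
        else if i < length (T b) \<and> fst (T b ! i) = (q, take k ns)
        then Some (Some (V_Run b (fst (snd (T b ! i))) 0 (fst (tick_actions ds cs)), (s, Right),
          snd (snd (T b ! i)) @ stay (drop k ns), snd (tick_actions ds cs), (out, Stay)))
        else None
    | _ \<Rightarrow> if s = Blank \<and> set cs \<subseteq> {Blank} \<and> q = accept_state (M b) \<and>
        (\<forall>r \<in> set (T b). fst r \<noteq> (q, take k ns)) then Some None else None)"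

text \<open>The decoded \<open>x\<close> goes both to the first work tape, as input of the selected
  machine, and to the output behind a leading 1. With \<open>c\<close> appended, the output is the
  correct rank for a member before membership has been checked.\<close>

fun verify_action :: "verify_state \<Rightarrow> symbol \<Rightarrow> symbol list \<Rightarrow> symbol list \<Rightarrow>
    symbol \<Rightarrow> (verify_state \<times> action \<times> action list \<times> action list \<times> action) option option" where
  "verify_action V_Start s ns cs out =
    Some (Some (V_Tag, (s, Stay), stay ns, replicate C (Aux 0, Right), (Bit True, Right)))"
| "verify_action V_Tag (Bit True) ns cs out =
    Some (Some (V_Bit, (Bit True, Right), stay ns, stay cs, (out, Stay)))"
| "verify_action V_Tag (Bit False) ns cs out =
    Some (Some (V_Rewind, (Bit False, Right), (hd ns, Left) # stay (tl ns),
      replicate C (Blank, Left), (out, Stay)))"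
| "verify_action V_Bit (Bit a) ns cs out =
    Some (Some (V_Tag, (Bit a, Right), (Bit a, Right) # stay (tl ns),
      replicate C (Aux 0, Right), (Bit a, Right)))"
| "verify_action V_Rewind s ns cs out =
    Some (Some (if hd ns = Blank then V_Sep1 else V_Rewind, (s, Stay),
      (hd ns, if hd ns = Blank then Right else Left) # stay (tl ns), stay cs, (out, Stay)))"
| "verify_action V_Sep1 (Bit c) ns cs out =
    Some (Some (V_Sep2, (Bit c, Right), stay ns, stay cs, (Bit c, Right)))"
| "verify_action V_Sep2 (Bit b) ns cs out =
    Some (Some (V_Run b (start_state (M b)) 0 (replicate C False), (Bit b, Right), stay ns, stay cs,
      (out, Stay)))"
| "verify_action (V_Run b q i ds) s ns cs out = verify_run b q i ds s ns cs out"
| "verify_action V_Erase s ns cs out = Some (if out = Blank then None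
    else Some (V_Erase, (s, Stay), stay ns, stay cs, (Blank, Left)))"
| "verify_action q s ns cs out = None"

definition verify_program :: "verify_state clocked_program" where
  "verify_program q s ns cs out = (case verify_action q s ns cs out of
      None \<Rightarrow> Some (V_Erase, (s, Stay), stay ns, stay cs, (out, Left))
    | Some r \<Rightarrow> r)"

abbreviation \<Delta> :: "verify_state program" where
  "\<Delta> \<equiv> layout K C verify_program"

lemma wf_M: "wf_tm (M b)" and set_T: "set (T b) = transitions (M b)"
  using choice_list[of b] by (auto simp: choice_list_def)

lemma tape_count_le_K: "1 \<le> tape_count (M b)" "tape_count (M b) \<le> K"
  using tape_count_pos[OF wf_M, of b] by (cases b; simp add: K_def)+

lemma K_pos: "K \<ge> 1"
  using tape_count_le_K[of True] by simp

lemma T_closed: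
  assumes "i < length (T b)"
  shows "fst (snd (T b ! i)) \<in> states_of (M b)" "length (snd (snd (T b ! i))) = tape_count (M b)"
    "fst ` set (snd (snd (T b ! i))) \<subseteq> symbols_of (M b)"
proof -
  have t: "T b ! i \<in> transitions (M b)"
    using assms set_T nth_mem by blast
  then show "fst (snd (T b ! i)) \<in> states_of (M b)"
    by (auto simp: states_of_def)
  show "length (snd (snd (T b ! i))) = tape_count (M b)"
    using t wf_M[of b] by (auto simp: wf_tm_def split_beta)
  show "fst ` set (snd (snd (T b ! i))) \<subseteq> symbols_of (M b)"
    using t by (auto simp: symbols_of_def)
qed

text \<open>Finiteness rests on the saturation of the index at \<open>length (T b)\<close> and on
  storing only the directions of the counters.\<close>

definition verify_states :: "verify_state set" where
  "verify_states = {V_Start, V_Tag, V_Bit, V_Rewind, V_Sep1, V_Sep2, V_Erase} \<union>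
    (\<Union>b. (\<lambda>(q, i, ds). V_Run b q i ds) `
      (states_of (M b) \<times> {..length (T b)} \<times> {ds. set ds \<subseteq> UNIV \<and> length ds = C}))"

definition verify_symbols :: "symbol set" where
  "verify_symbols = insert (Aux 0) (\<Union>b. symbols_of (M b))"

lemma V_Run_in_states [simp]:
  "V_Run b q i ds \<in> verify_states \<longleftrightarrow> q \<in> states_of (M b) \<and> i \<le> length (T b) \<and> length ds = C"
  by (auto simp: verify_states_def image_iff)

lemma verify_symbols_basic [simp]:
  "Blank \<in> verify_symbols" "Bit b \<in> verify_symbols" "Aux 0 \<in> verify_symbols"
  by (auto simp: verify_symbols_def)

lemma verify_run_closed:
  assumes "i \<le> length (T b)" "q \<in> states_of (M b)" "length ds = C" "length ns = K" "length cs = C"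
    and "s \<in> verify_symbols" "set ns \<subseteq> verify_symbols" "set cs \<subseteq> verify_symbols" "out \<in> verify_symbols"
    and "verify_run b q i ds s ns cs out = Some (Some (q', a, nas, cas, o'))"
  shows "q' \<in> verify_states \<and> length nas = K \<and> length cas = C \<and> fst a \<in> verify_symbols \<and>
      fst ` set nas \<subseteq> verify_symbols \<and> fst ` set cas \<subseteq> verify_symbols \<and> fst o' \<in> verify_symbols"
proof -
  obtain w where s: "s = Bit w"
    using assms(10) by (cases s) (auto simp: verify_run_def Let_def split: if_splits)
  obtain ds' as where t: "tick_actions ds cs = (ds', as)"
    by fastforce
  then have as: "length ds' = C" "length as = C" "fst ` set as \<subseteq> verify_symbols"
    using tick_actions_closed[of ds cs ds' as] assms by auto
  show ?thesis
  proof (cases w)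
    case False
    then have "q' = V_Run b q (min (Suc i) (length (T b))) ds'" "a = (s, Right)" "nas = stay ns"
      "cas = as" "o' = (out, Stay)"
      using assms(10) t s by (auto simp: verify_run_def Let_def split: if_splits)
    then show ?thesis
      using assms as by simp
  next
    case True
    then have i: "i < length (T b)" and eq: "q' = V_Run b (fst (snd (T b ! i))) 0 ds'" "a = (s, Right)"
      "nas = snd (snd (T b ! i)) @ stay (drop (tape_count (M b)) ns)" "cas = as" "o' = (out, Stay)"
      using assms(10) t s by (auto simp: verify_run_def Let_def split: if_splits)
    have "fst ` set nas = fst ` set (snd (snd (T b ! i))) \<union> set (drop (tape_count (M b)) ns)"
      unfolding eq by (simp add: image_Un)
    moreover have "symbols_of (M b) \<subseteq> verify_symbols"
      by (auto simp: verify_symbols_def)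
    ultimately have "fst ` set nas \<subseteq> verify_symbols"
      using T_closed(3)[OF i] set_drop_subset[of "tape_count (M b)" ns] assms(7) by auto
    then show ?thesis
      using T_closed(1,2)[OF i] assms as eq tape_count_le_K[of b] by simp
  qed
qed

lemma verify_action_closed:
  assumes "q \<in> verify_states" "length ns = K" "length cs = C"
    and "s \<in> verify_symbols" "set ns \<subseteq> verify_symbols" "set cs \<subseteq> verify_symbols" "out \<in> verify_symbols"
    and "verify_action q s ns cs out = Some (Some (q', a, nas, cas, o'))"
  shows "q' \<in> verify_states \<and> length nas = K \<and> length cas = C \<and> fst a \<in> verify_symbols \<and>
      fst ` set nas \<subseteq> verify_symbols \<and> fst ` set cas \<subseteq> verify_symbols \<and> fst o' \<in> verify_symbols"
proof (cases "\<exists>b p i ds. q = V_Run b p i ds")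
  case True
  then obtain b p i ds where q: "q = V_Run b p i ds"
    by blast
  show ?thesis
    using assms(1,8) unfolding q V_Run_in_states verify_action.simps
    by (elim conjE) (rule verify_run_closed[OF _ _ _ assms(2-7)])
next
  case False
  have ns: "ns \<noteq> []"
    using assms(2) K_pos by auto
  then have ns': "hd ns \<in> verify_symbols" "set (tl ns) \<subseteq> verify_symbols"
    using assms(5) by (auto dest: list.set_sel)
  have states: "{V_Start, V_Tag, V_Bit, V_Rewind, V_Sep1, V_Sep2, V_Erase} \<subseteq> verify_states"
    by (auto simp: verify_states_def)
  have start: "V_Run b (start_state (M b)) 0 (replicate C False) \<in> verify_states" for b
    by simp
  show ?thesis
    using assms(2-) False ns' states start ns K_pos
    by (cases "(q, s, ns, cs, out)" rule: verify_action.cases)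
      (auto split: if_splits simp del: V_Run_in_states)
qed

lemma program_verify: "program (K + C + 2) verify_states verify_symbols \<Delta> V_Start"
proof (rule program_layout)
  show "finite verify_states"
    using finite_states_of[OF wf_M] finite_lists_length_eq[of "UNIV :: bool set" C]
    by (simp add: verify_states_def)
  show "finite verify_symbols"
    using finite_symbols_of[OF wf_M] by (simp add: verify_symbols_def)
  show "V_Start \<in> verify_states" "{Blank, Bit False, Bit True} \<subseteq> verify_symbols"
    by (auto simp: verify_states_def)
next
  fix q s ns cs out q' a nas cas b
  assume h: "q \<in> verify_states" "length ns = K" "length cs = C" "s \<in> verify_symbols"
    "set ns \<subseteq> verify_symbols" "set cs \<subseteq> verify_symbols" "out \<in> verify_symbols"
    "verify_program q s ns cs out = Some (q', a, nas, cas, b)"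
  show "q' \<in> verify_states \<and> length nas = K \<and> length cas = C \<and> fst a \<in> verify_symbols \<and>
      fst ` set nas \<subseteq> verify_symbols \<and> fst ` set cas \<subseteq> verify_symbols \<and> fst b \<in> verify_symbols"
  proof (cases "verify_action q s ns cs out")
    case None
    then show ?thesis
      using h by (auto simp: verify_program_def verify_states_def)
  next
    case (Some r)
    then show ?thesis
      using h verify_action_closed[OF h(1-7)] by (auto simp: verify_program_def)
  qed
qed

section \<open>Correctness and running time of the verifier\<close>

definition finishes :: "nat \<Rightarrow> verify_state \<times> (tape \<times> int) list \<Rightarrow> str \<Rightarrow> bool" where
  "finishes n c u \<longleftrightarrow> (\<exists>t q ts. t \<le> n \<and> runs \<Delta> t c (q, ts) \<and> \<Delta> q (scanned ts) = None \<and>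
    fst (last ts) = str_tape u)"

lemma finishes_trans: "runs \<Delta> t c d \<Longrightarrow> finishes n d u \<Longrightarrow> finishes (t + n) c u"
  unfolding finishes_def by (meson add_left_mono runs_trans)

lemma finishes_mono: "finishes m c u \<Longrightarrow> m \<le> n \<Longrightarrow> finishes n c u"
  unfolding finishes_def using le_trans by blast

lemma runs_action:
  assumes "verify_action q (read z) (scanned ns) (scanned cs) (read out) = Some (Some (q', a, nas, cas, b))"
    and "length ns = K" "length cs = C" "length nas = K" "length cas = C"
  shows "runs \<Delta> 1 (q, z # ns @ cs @ [out])
    (q', act a z # map2 act nas ns @ map2 act cas cs @ [act b out])"
  using assms by (intro runs_layout) (auto simp: verify_program_def)

lemma runs_erase:
  assumes "length ns = K" "length cs = C"
  shows "runs \<Delta> (length u) (V_Erase, z # ns @ cs @ [(str_tape u, int (length u) - 1)])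
    (V_Erase, z # ns @ cs @ [(str_tape [], - 1)])"
proof (induction u rule: rev_induct)
  case Nil
  show ?case
    by (simp add: runs_0)
next
  case (snoc a u)
  have "(str_tape (u @ [a]))(int (length u) := Blank) = str_tape u"
    by (auto simp: str_tape_def fun_eq_iff nth_append)
  moreover have "str_tape (u @ [a]) (int (length u)) = Bit a"
    by (simp add: str_tape_def)
  ultimately have "runs \<Delta> 1 (V_Erase, z # ns @ cs @ [(str_tape (u @ [a]), int (length (u @ [a])) - 1)])
    (V_Erase, z # ns @ cs @ [(str_tape u, int (length u) - 1)])"
    using runs_action[of V_Erase z ns cs "(str_tape (u @ [a]), int (length u))"] assms by simp
  then show ?case
    using runs_trans[OF _ snoc.IH] by fastforce
qed

text \<open>One step moves the output head back onto the last written symbol, and each of the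
  \<open>length u\<close> symbols is then erased by one step.\<close>

lemma finishes_reject:
  assumes "verify_action q (read z) (scanned ns) (scanned cs) Blank = None"
    and "length ns = K" "length cs = C"
  shows "finishes (Suc (length u)) (q, z # ns @ cs @ [writer u]) []"
proof -
  have "act (Blank, Left) (writer u) = (str_tape u, int (length u) - 1)"
    by (auto simp: writer_def str_tape_def fun_eq_iff)
  then have r: "runs \<Delta> 1 (q, z # ns @ cs @ [writer u]) (V_Erase, z # ns @ cs @ [(str_tape u, int (length u) - 1)])"
    using runs_layout[of verify_program q z ns cs "writer u" V_Erase "(read z, Stay)" "stay (scanned ns)"
      "stay (scanned cs)" "(Blank, Left)" K C] assms by (simp add: verify_program_def)
  have "\<Delta> V_Erase (scanned (z # ns @ cs @ [(str_tape [], - 1)])) = None"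
    using assms(2,3) by (subst layout_scanned) (auto simp: verify_program_def)
  then have "finishes (length u) (V_Erase, z # ns @ cs @ [(str_tape u, int (length u) - 1)]) []"
    unfolding finishes_def using runs_erase[OF assms(2,3), of u z]
    by (intro exI[of _ "length u"] exI[of _ V_Erase] exI[of _ "z # ns @ cs @ [(str_tape [], - 1)]"]) auto
  from finishes_trans[OF r this] show ?thesis
    by simp
qed

lemma halted_iff: "halted (M b) (q, ts) \<longleftrightarrow> (\<forall>r \<in> set (T b). fst r \<noteq> (q, scanned ts))"
  unfolding set_T halted_def step_def by fastforce

text \<open>The program replays \<open>bit_run\<close> with one tick per bit, so the clock expires
  exactly at the end of the input if and only if \<open>w\<close> has the prescribed length. The
  tapes \<open>ex\<close> are the work tapes beyond those of the selected machine.\<close>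

lemma finishes_V_Run:
  assumes "z = p @ w" "length ts = tape_count (M b)" "length ts + length ex = K" "clock C m cs"
  shows "finishes (length w + Suc (length u))
    (V_Run b q i (map fst cs), (str_tape z, int (length p)) # (ts @ ex) @ map (counter m) cs @ [writer u])
    (if length w = time_left m cs \<and> (\<exists>j d. bit_run (T b) w (i, (q, ts)) = Some (j, d) \<and>
      halted (M b) d \<and> fst d = accept_state (M b)) then u else [])"
  using assms
proof (induction w arbitrary: p q i ts cs)
  case Nil
  let ?ts = "(str_tape z, int (length p)) # (ts @ ex) @ map (counter m) cs @ [writer u]"
  have s: "str_tape z (int (length p)) = Blank"
    using Nil by (simp add: str_tape_def)
  have cs: "length cs = C"
    using Nil by (simp add: clock_def)
  note time = time_left_0_iff[OF Nil.prems(4)]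
  show ?case
  proof (cases "time_left m cs = 0 \<and> halted (M b) (q, ts) \<and> q = accept_state (M b)")
    case True
    then have "verify_action (V_Run b q i (map fst cs)) (str_tape z (int (length p))) (scanned (ts @ ex))
        (scanned (map (counter m) cs)) Blank = Some None"
      using s time Nil.prems by (auto simp: verify_run_def halted_iff)
    then have "\<Delta> (V_Run b q i (map fst cs)) (scanned ?ts) = None"
      using cs Nil.prems by (subst layout_scanned) (auto simp: verify_program_def)
    then show ?thesis
      using True runs_0[of \<Delta> "(V_Run b q i (map fst cs), ?ts)"] unfolding finishes_def
      by (intro exI[of _ 0] exI[of _ "V_Run b q i (map fst cs)"] exI[of _ ?ts]) auto
  next
    case False
    then have "verify_action (V_Run b q i (map fst cs)) (str_tape z (int (length p))) (scanned (ts @ ex))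
        (scanned (map (counter m) cs)) Blank = None"
      using s time Nil.prems by (auto simp: verify_run_def halted_iff)
    then show ?thesis
      using finishes_reject[of "V_Run b q i (map fst cs)" "(str_tape z, int (length p))" "ts @ ex"
          "map (counter m) cs" u] False Nil.prems cs by auto
  qed
next
  case (Cons a w)
  let ?z = "(str_tape z, int (length p))"
  let ?z' = "(str_tape z, int (length (p @ [a])))"
  have s: "str_tape z (int (length p)) = Bit a"
    using Cons.prems by (simp add: str_tape_def)
  then have z': "act (Bit a, Right) ?z = ?z'"
    by (auto simp: fun_eq_iff)
  have cs: "length cs = C" "\<forall>(d, r) \<in> set cs. r \<le> m"
    using Cons.prems by (auto simp: clock_def)
  note time = time_left_0_iff[OF Cons.prems(4)]
  obtain ds as where t: "tick_actions (map fst cs) (scanned (map (counter m) cs)) = (ds, as)"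
    by fastforce
  have as: "length as = C" "ds = map fst (tick m cs)"
    "map2 act as (map (counter m) cs) = map (counter m) (tick m cs)"
    using tick_actions_closed[OF _ t] tick_actions_counters[OF cs(2) t] cs(1) by auto
  have ns: "length (ts @ ex) = K"
    using Cons.prems by simp
  let ?q = "V_Run b q i (map fst cs)"
  have reject: ?case
    if "verify_action ?q (read ?z) (scanned (ts @ ex)) (scanned (map (counter m) cs)) Blank = None"
      "\<not> (length (a # w) = time_left m cs \<and> (\<exists>j d. bit_run (T b) (a # w) (i, (q, ts)) = Some (j, d) \<and>
      halted (M b) d \<and> fst d = accept_state (M b)))"
  proof -
    have "finishes (Suc (length u)) (?q, ?z # (ts @ ex) @ map (counter m) cs @ [writer u]) []"
      using finishes_reject[OF that(1) ns] cs(1) by simp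
    then show ?thesis
      using finishes_mono[of "Suc (length u)" _ "[]" "length (a # w) + Suc (length u)"] that(2) by auto
  qed
  show ?case
  proof (cases "time_left m cs = 0")
    \<comment> \<open>The clock has expired while bits remain, so \<open>w\<close> is too
      long.\<close>
    case True
    then show ?thesis
      using reject s time by (auto simp: verify_run_def)
  next
    case False
    then have left: "time_left m cs = Suc (time_left m (tick m cs))"
      using time_left_tick by simp
    have nb: "\<not> set (scanned (map (counter m) cs)) \<subseteq> {Blank}"
      using False time by simp
    have continue: ?thesis
      if r: "runs \<Delta> 1 (?q, ?z # (ts @ ex) @ map (counter m) cs @ [writer u])
          (V_Run b q' i' ds, ?z' # (ts' @ ex) @ map (counter m) (tick m cs) @ [writer u])"
        and step: "bit_step (T b) a (i, (q, ts)) = Some (i', (q', ts'))"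
        and len: "length ts' = tape_count (M b)" for q' i' ts'
    proof -
      have "finishes (length w + Suc (length u))
        (V_Run b q' i' (map fst (tick m cs)), ?z' # (ts' @ ex) @ map (counter m) (tick m cs) @ [writer u])
        (if length w = time_left m (tick m cs) \<and> (\<exists>j d. bit_run (T b) w (i', (q', ts')) = Some (j, d) \<and>
          halted (M b) d \<and> fst d = accept_state (M b)) then u else [])"
        using Cons.prems len by (intro Cons.IH tick_clock) auto
      from finishes_trans[OF r[unfolded as(2)] this] show ?thesis
        using left step by simp
    qed
    show ?thesis
    proof (cases a)
      case False
      have "verify_action ?q (read ?z) (scanned (ts @ ex)) (scanned (map (counter m) cs)) (read (writer u)) =
        Some (Some (V_Run b q (min (Suc i) (length (T b))) ds, (Bit a, Right), stay (scanned (ts @ ex)), as,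
          (Blank, Stay)))"
        using s t nb False by (simp add: verify_run_def Let_def)
      from runs_action[OF this ns] have "runs \<Delta> 1 (?q, ?z # (ts @ ex) @ map (counter m) cs @ [writer u])
          (V_Run b q (min (Suc i) (length (T b))) ds, ?z' # (ts @ ex) @ map (counter m) (tick m cs) @ [writer u])"
        using as cs ns act_stay[of "writer u"] by (simp add: z' del: act.simps scanned_append)
      then show ?thesis
        using continue False Cons.prems by simp
    next
      case True
      show ?thesis
      proof (cases "i < length (T b) \<and> fst (T b ! i) = (q, scanned ts)")
        case i: True
        let ?q' = "fst (snd (T b ! i))" and ?as = "snd (snd (T b ! i))"
        have len: "length ?as = length ts"
          using T_closed(2) i Cons.prems by simp
        have "verify_action ?q (read ?z) (scanned (ts @ ex)) (scanned (map (counter m) cs)) (read (writer u)) =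
          Some (Some (V_Run b ?q' 0 ds, (Bit a, Right), ?as @ stay (scanned ex), as, (Blank, Stay)))"
          using s t nb True i Cons.prems by (simp add: verify_run_def Let_def)
        from runs_action[OF this ns] have "runs \<Delta> 1 (?q, ?z # (ts @ ex) @ map (counter m) cs @ [writer u])
            (V_Run b ?q' 0 ds, ?z' # (map2 act ?as ts @ ex) @ map (counter m) (tick m cs) @ [writer u])"
          using as cs ns len act_stay[of "writer u"] by (simp add: z' del: act.simps)
        then show ?thesis
          using continue True i len Cons.prems by simp
      next
        case i: False
        then have "bit_step (T b) a (i, (q, ts)) = None"
          using True by simp
        then show ?thesis
          using s t nb True i Cons.prems by (intro reject) (auto simp: verify_run_def Let_def)
      qed
    qed
  qed
qed

text \<open>The invariant of the decoding phase: the decoded part \<open>x\<close> is present on the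
  first work tape, in unary on the counters with the extra mark from \<open>V_Start\<close>, and on
  the output behind its leading 1.\<close>

definition reading :: "verify_state \<Rightarrow> str \<Rightarrow> nat \<Rightarrow> str \<Rightarrow> verify_state \<times> (tape \<times> int) list" where
  "reading q z i x = (q, (str_tape z, int i) # (writer x # replicate (K - 1) (writer [])) @
    replicate C (marker (Suc (length x))) @ [writer (True # x)])"

lemma runs_V_Start: "runs \<Delta> 1 (V_Start, start_tapes (K + C + 2) z) (reading V_Tag z 0 [])"
proof -
  have "replicate K (writer []) = writer [] # replicate (K - 1) (writer [])"
    using K_pos by (cases K) auto
  moreover have "act (Bit True, Right) (writer []) = writer [True]" "act (Aux 0, Right) (writer []) = marker 1"
    using write_bit[of True "[]"] act_marker[of 0] by (simp_all add: marker_0 del: act.simps)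
  ultimately show ?thesis
    using runs_action[of V_Start "(str_tape z, 0)" "replicate K (writer [])" "replicate C (writer [])" "writer []"]
      map2_act_stay[of "replicate K (writer [])"] act_stay[of "(str_tape z, 0)"] K_pos
    unfolding start_tapes_layout reading_def
    by (simp del: act.simps)
qed

lemma act_read_str_tape: "str_tape z i = s \<Longrightarrow> act (s, m) (str_tape z, i) = (str_tape z, i + shift m)"
  by auto

lemma runs_V_Tag_True:
  assumes "str_tape z (int i) = Bit True"
  shows "runs \<Delta> 1 (reading V_Tag z i x) (reading V_Bit z (Suc i) x)"
  using runs_action[of V_Tag "(str_tape z, int i)" "writer x # replicate (K - 1) (writer [])"
      "replicate C (marker (Suc (length x)))" "writer (True # x)"] K_pos act_read_str_tape[OF assms]
    act_stay[of "writer x"] act_stay[of "writer (True # x)"] assms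
  unfolding reading_def by (simp add: add.commute del: act.simps)

lemma runs_V_Bit:
  assumes "str_tape z (int i) = Bit a"
  shows "runs \<Delta> 1 (reading V_Bit z i x) (reading V_Tag z (Suc i) (x @ [a]))"
  using runs_action[of V_Bit "(str_tape z, int i)" "writer x # replicate (K - 1) (writer [])"
      "replicate C (marker (Suc (length x)))" "writer (True # x)"] K_pos act_read_str_tape[OF assms]
    assms
  unfolding reading_def by (simp add: add.commute del: act.simps)

lemma str_tape_nth: "z = p @ a # r \<Longrightarrow> str_tape z (int (length p)) = Bit a"
  by (simp add: str_tape_def)

lemma str_tape_end: "str_tape z (int (length z)) = Blank"
  by (simp add: str_tape_def)

lemma runs_V_Tag_Bit:
  assumes "z = p @ True # a # r"
  shows "runs \<Delta> 2 (reading V_Tag z (length p) x) (reading V_Tag z (Suc (Suc (length p))) (x @ [a]))"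
proof -
  have "str_tape z (int (length p)) = Bit True" "str_tape z (int (Suc (length p))) = Bit a"
    using str_tape_nth[OF assms] str_tape_nth[of z "p @ [True]" a r] assms by auto
  from runs_trans[OF runs_V_Tag_True[OF this(1)] runs_V_Bit[OF this(2)], of x] show ?thesis
    by (simp add: numeral_2_eq_2)
qed

lemma runs_reading:
  "z = p @ tagged v @ r \<Longrightarrow>
    runs \<Delta> (2 * length v) (reading V_Tag z (length p) u) (reading V_Tag z (length p + 2 * length v) (u @ v))"
proof (induction v arbitrary: p u)
  case Nil
  show ?case
    by (simp add: runs_0)
next
  case (Cons a v)
  have "runs \<Delta> (2 * length v) (reading V_Tag z (length (p @ [True, a])) (u @ [a]))
    (reading V_Tag z (length (p @ [True, a]) + 2 * length v) ((u @ [a]) @ v))"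
    using Cons.prems by (intro Cons.IH) simp
  moreover have "runs \<Delta> 2 (reading V_Tag z (length p) u) (reading V_Tag z (length (p @ [True, a])) (u @ [a]))"
    using runs_V_Tag_Bit[of z p a "tagged v @ r" u] Cons.prems by simp
  ultimately show ?case
    using runs_trans[of \<Delta> 2 _ _ "2 * length v"] by fastforce
qed

lemma finishes_reading_reject:
  assumes "verify_action q (str_tape z (int i)) (scanned (writer x # replicate (K - 1) (writer [])))
      (scanned (replicate C (marker (Suc (length x))))) Blank = None"
  shows "finishes (length x + 2) (reading q z i x) []"
  using finishes_reject[of q "(str_tape z, int i)" "writer x # replicate (K - 1) (writer [])"
      "replicate C (marker (Suc (length x)))" "True # x"] assms K_pos
  unfolding reading_def by simp

text \<open>A 0 at a tag position would be the missing delimiter. So every tag is 1, and the input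
  ends during decoding, either where a tag or where a data bit is expected.\<close>

lemma finishes_undelimited:
  "z = p @ r \<Longrightarrow> \<nexists>x s. r = tagged x @ False # s \<Longrightarrow>
    finishes (2 * length r + length u + 3) (reading V_Tag z (length p) u) []"
proof (induction r arbitrary: p u rule: induct_list012)
  case 1
  then show ?case
    using finishes_mono[OF finishes_reading_reject[of V_Tag z "length p" u]] str_tape_end[of p] by simp
next
  case (2 a)
  then have a: a
    using 2(2)[unfolded not_ex, rule_format, of "[]"] by auto
  then have "str_tape z (int (length p)) = Bit True"
    using str_tape_nth[of z p a "[]"] 2 by simp
  moreover have "finishes (length u + 2) (reading V_Bit z (Suc (length p)) u) []"
    using finishes_reading_reject[of V_Bit z "Suc (length p)" u] str_tape_end[of z] 2 by simp
  ultimately have "finishes (1 + (length u + 2)) (reading V_Tag z (length p) u) []"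
    using finishes_trans runs_V_Tag_True by blast
  then show ?case
    by (rule finishes_mono) simp
next
  case (3 a b r)
  have a: a
    using 3(4)[unfolded not_ex, rule_format, of "[]"] by auto
  have "\<nexists>x s. r = tagged x @ False # s"
  proof
    assume "\<exists>x s. r = tagged x @ False # s"
    then obtain x s where "a # b # r = tagged (b # x) @ False # s"
      using a by auto
    then show False
      using 3(4) by blast
  qed
  then have "finishes (2 * length r + length (u @ [b]) + 3) (reading V_Tag z (length (p @ [a, b])) (u @ [b])) []"
    using 3 by (intro "3.IH") auto
  moreover have "runs \<Delta> 2 (reading V_Tag z (length p) u) (reading V_Tag z (length (p @ [a, b])) (u @ [b]))"
    using runs_V_Tag_Bit[of z p b r u] 3(3) a by simp
  ultimately have "finishes (2 + (2 * length r + length (u @ [b]) + 3)) (reading V_Tag z (length p) u) []"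
    using finishes_trans by blast
  then show ?case
    by (rule finishes_mono) simp
qed

text \<open>The head walks left to the blank at cell -1 and then steps right, so \<open>x\<close>
  ends up as the input of a fresh start configuration.\<close>

lemma runs_V_Rewind:
  assumes "length ns = K - 1" "length cs = C"
  shows "j \<le> length x \<Longrightarrow>
    runs \<Delta> (Suc j) (V_Rewind, z # ((str_tape x, int j - 1) # ns) @ cs @ [out])
      (V_Sep1, z # ((str_tape x, 0) # ns) @ cs @ [out])"
proof (induction j)
  case 0
  have "str_tape x (- 1) = Blank"
    by (simp add: str_tape_def)
  then show ?case
    using runs_action[of V_Rewind z "(str_tape x, - 1) # ns" cs out] assms K_pos act_stay[of out] act_stay[of z]
    by (simp add: act_read_str_tape del: act.simps act_stay)
next
  case (Suc j)
  have s: "str_tape x (int j) \<noteq> Blank"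
    using Suc.prems by (simp add: str_tape_def)
  then have "runs \<Delta> 1 (V_Rewind, z # ((str_tape x, int (Suc j) - 1) # ns) @ cs @ [out])
      (V_Rewind, z # ((str_tape x, int j - 1) # ns) @ cs @ [out])"
    using runs_action[of V_Rewind z "(str_tape x, int j) # ns" cs out] assms K_pos act_stay[of out] act_stay[of z]
    by (simp add: act_read_str_tape del: act.simps act_stay)
  from runs_trans[OF this Suc.IH] show ?case
    using Suc.prems by simp
qed

text \<open>Both machines use the same \<open>K\<close> work tapes; for the machine selected by
  \<open>b\<close> they form its start configuration followed by surplus blank tapes.\<close>

lemma start_tapes_padded:
  "(str_tape x, 0) # replicate (K - 1) (writer []) =
    start_tapes (tape_count (M b)) x @ replicate (K - tape_count (M b)) (writer [])"
proof -
  have "K - 1 = (tape_count (M b) - 1) + (K - tape_count (M b))"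
    using tape_count_le_K[of b] by simp
  then have "replicate (K - 1) (writer []) =
      replicate (tape_count (M b) - 1) (writer []) @ replicate (K - tape_count (M b)) (writer [])"
    by (metis replicate_add)
  then show ?thesis
    by (simp add: start_tapes_def writer_def)
qed

lemma finishes_delimited:
  fixes x r
  defines "z \<equiv> tagged x @ False # r" and "m \<equiv> Suc (length x)"
  assumes "finishes n (V_Sep1, (str_tape z, int (2 * length x + 1)) #
      ((str_tape x, 0) # replicate (K - 1) (writer [])) @ map (counter m) (replicate C (False, m)) @
      [writer (True # x)]) u"
  shows "finishes (3 * length x + 3 + n) (V_Start, start_tapes (K + C + 2) z) u"
proof -
  have s: "str_tape z (int (2 * length x)) = Bit False"
    using str_tape_nth[of z "tagged x" False r] by (simp add: z_def)
  have turn: "act (Blank, Left) (writer x) = (str_tape x, int (length x) - 1)"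
    by (auto simp: writer_def str_tape_def fun_eq_iff)
  have r1: "runs \<Delta> (2 * length x) (reading V_Tag z 0 []) (reading V_Tag z (2 * length x) x)"
    using runs_reading[of z "[]" x "False # r" "[]"] by (simp add: z_def)
  have r2: "runs \<Delta> 1 (reading V_Tag z (2 * length x) x) (V_Rewind, (str_tape z, int (2 * length x + 1)) #
      ((str_tape x, int (length x) - 1) # replicate (K - 1) (writer [])) @
      map (counter m) (replicate C (False, m)) @ [writer (True # x)])"
    using runs_action[of V_Tag "(str_tape z, int (2 * length x))" "writer x # replicate (K - 1) (writer [])"
      "replicate C (marker m)" "writer (True # x)"] K_pos s act_read_str_tape[OF s] turn
      act_stay[of "writer (True # x)"]
    unfolding reading_def m_def[symmetric] by (simp add: add.commute del: act.simps counter.simps)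
  have r3: "runs \<Delta> (Suc (length x)) (V_Rewind, (str_tape z, int (2 * length x + 1)) #
      ((str_tape x, int (length x) - 1) # replicate (K - 1) (writer [])) @
      map (counter m) (replicate C (False, m)) @ [writer (True # x)])
      (V_Sep1, (str_tape z, int (2 * length x + 1)) #
      ((str_tape x, 0) # replicate (K - 1) (writer [])) @ map (counter m) (replicate C (False, m)) @
      [writer (True # x)])"
    by (rule runs_V_Rewind) auto
  show ?thesis
    using finishes_trans[OF runs_trans[OF runs_trans[OF runs_trans[OF runs_V_Start r1] r2] r3] assms(3)]
    by (rule finishes_mono) simp
qed

text \<open>After the delimiter a block needs the bits \<open>c\<close> and \<open>b\<close>.
  Shorter remainders belong to no block and are rejected; otherwise the rest is simulated as
  \<open>w\<close>.\<close>

lemma finishes_Sep: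
  fixes x r
  defines "z \<equiv> tagged x @ False # r" and "m \<equiv> Suc (length x)"
  shows "finishes (2 * length r + length x + 8) (V_Sep1, (str_tape z, int (2 * length x + 1)) #
      ((str_tape x, 0) # replicate (K - 1) (writer [])) @ map (counter m) (replicate C (False, m)) @
      [writer (True # x)]) (output_of (if z \<in> blocks then Some (rank_in blocks z) else None))"
    (is "finishes _ (V_Sep1, ?z1 # ?ns @ ?cs @ _) _")
proof -
  have len: "length ?ns = K" "length ?cs = C"
    using K_pos by auto
  have z1: "z = (tagged x @ [False]) @ r"
    by (simp add: z_def)
  show ?thesis
  proof (cases r)
    case Nil
    have "z \<notin> blocks"
      using Nil tagged_delimited[of x "[]"] unfolding blocks_def z_def block_def by (auto simp: tagged_delimited)
    moreover have "str_tape z (int (2 * length x + 1)) = Blank"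
      using str_tape_end[of z] Nil by (simp add: z_def add.commute)
    then have "finishes (Suc (length (True # x))) (V_Sep1, ?z1 # ?ns @ ?cs @ [writer (True # x)]) []"
      using len by (intro finishes_reject) auto
    ultimately show ?thesis
      by (auto intro: finishes_mono)
  next
    case (Cons c r')
    let ?z2 = "(str_tape z, int (2 * length x + 2))"
    have s: "str_tape z (int (2 * length x + 1)) = Bit c"
      using str_tape_nth[of z "tagged x @ [False]" c r'] Cons by (simp add: z_def add.commute)
    then have r1: "runs \<Delta> 1 (V_Sep1, ?z1 # ?ns @ ?cs @ [writer (True # x)])
        (V_Sep2, ?z2 # ?ns @ ?cs @ [writer (True # x @ [c])])"
      using runs_action[of V_Sep1 ?z1 ?ns ?cs "writer (True # x)"] len act_read_str_tape[OF s]
        map2_act_stay[of ?ns] map2_act_stay[of ?cs]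
      by (simp add: algebra_simps del: act.simps map_replicate scanned_simps zip_Cons_Cons)
    show ?thesis
    proof (cases r')
      case Nil
      have "z \<notin> blocks"
        using Cons Nil unfolding blocks_def z_def block_def by (auto simp: tagged_delimited)
      moreover have "str_tape z (int (2 * length x + 2)) = Blank"
        using str_tape_end[of z] Cons Nil by (simp add: z_def add.commute)
      then have "finishes (Suc (length (True # x @ [c]))) (V_Sep2, ?z2 # ?ns @ ?cs @ [writer (True # x @ [c])]) []"
        using len by (intro finishes_reject) auto
      from finishes_trans[OF r1 this] have "finishes (length x + 4) (V_Sep1, ?z1 # ?ns @ ?cs @ [writer (True # x)]) []"
        by (rule finishes_mono) simp
      ultimately show ?thesis
        by (auto intro: finishes_mono)
    next
      case (Cons b w)
      let ?z3 = "(str_tape z, int (length (tagged x @ [False, c, b])))"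
      let ?q = "V_Run b (start_state (M b)) 0 (map fst (replicate C (False, m)))"
      have z: "z = block x c b w" "z = (tagged x @ [False, c, b]) @ w"
        using \<open>r = c # r'\<close> Cons by (auto simp: z_def block_def)
      have s: "str_tape z (int (2 * length x + 2)) = Bit b"
        using str_tape_nth[of z "tagged x @ [False, c]" b w] z(2) by (simp add: add.commute)
      then have r2: "runs \<Delta> 1 (V_Sep2, ?z2 # ?ns @ ?cs @ [writer (True # x @ [c])])
          (?q, ?z3 # ?ns @ ?cs @ [writer (True # x @ [c])])"
        using runs_action[of V_Sep2 ?z2 ?ns ?cs "writer (True # x @ [c])"] len act_read_str_tape[OF s]
          map2_act_stay[of ?ns] map2_act_stay[of ?cs] act_stay[of "writer (True # x @ [c])"]
        by (simp add: algebra_simps del: act.simps scanned_simps zip_Cons_Cons)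
      have "length (start_tapes (tape_count (M b)) x) = tape_count (M b)"
        using tape_count_le_K[of b] by simp
      then have "finishes (length w + Suc (length (True # x @ [c]))) (?q, ?z3 # ?ns @ ?cs @ [writer (True # x @ [c])])
        (if length w = ticks C (length x) \<and> bit_accepts (M b) (T b) x w then True # x @ [c] else [])"
        using finishes_V_Run[OF z(2), of "start_tapes (tape_count (M b)) x" b
            "replicate (K - tape_count (M b)) (writer [])" m "replicate C (False, m)"
            "True # x @ [c]" "start_state (M b)" 0] clock_start[of C m False] tape_count_le_K[of b]
          time_left_start[of "length x" C False]
        unfolding start_tapes_padded[of x b] bit_accepts_def init_config_eq m_def by simp
      \<comment> \<open>A member has the rank \<open>num_of_str (x @ [c])\<close>, and the string
        identified with that number is \<open>xc\<close> itself.\<close>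
      moreover have "(if length w = ticks C (length x) \<and> bit_accepts (M b) (T b) x w then True # x @ [c] else []) =
        output_of (if z \<in> blocks then Some (rank_in blocks z) else None)"
        using rank_in_blocks_member[of x c b w] unfolding z(1) by (simp add: block_in_blocks)
      ultimately have "finishes (1 + 1 + (length w + Suc (length (True # x @ [c]))))
        (V_Sep1, ?z1 # ?ns @ ?cs @ [writer (True # x)])
        (output_of (if z \<in> blocks then Some (rank_in blocks z) else None))"
        using finishes_trans[OF runs_trans[OF r1 r2]] by simp
      then show ?thesis
        by (rule finishes_mono) (use \<open>r = c # r'\<close> Cons in simp)
    qed
  qed
qed

lemma finishes_verify:
  "finishes (8 * length z + 16) (V_Start, start_tapes (K + C + 2) z)
    (output_of (if z \<in> blocks then Some (rank_in blocks z) else None))"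
proof (cases "\<exists>x r. z = tagged x @ False # r")
  case True
  then obtain x r where z: "z = tagged x @ False # r"
    by blast
  show ?thesis
    unfolding z by (rule finishes_mono[OF finishes_delimited[OF finishes_Sep]]) simp
next
  case False
  then have "z \<notin> blocks"
    by (auto simp: blocks_def block_def)
  moreover have "finishes (2 * length z + 3) (reading V_Tag z 0 []) []"
    using finishes_undelimited[of z "[]" z "[]"] False by simp
  from finishes_trans[OF runs_V_Start this]
  have "finishes (1 + (2 * length z + 3)) (V_Start, start_tapes (K + C + 2) z) []" .
  ultimately show ?thesis
    by (auto intro: finishes_mono)
qed

lemma semistrong_P_rankable_blocks: "semistrong_P_rankable blocks"
proof -
  have "polytime_computable (\<lambda>z. output_of (if z \<in> blocks then Some (rank_in blocks z) else None))"
  proof (rule program.polytime_computableI[OF program_verify, of "[:16, 8:]"])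
    fix z
    show "\<exists>t q ts. runs \<Delta> t (V_Start, start_tapes (K + C + 2) z) (q, ts) \<and> \<Delta> q (scanned ts) = None \<and>
      t \<le> poly [:16, 8:] (length z) \<and>
      fst (last ts) = str_tape (output_of (if z \<in> blocks then Some (rank_in blocks z) else None))"
    proof -
      obtain t q ts where t: "t \<le> 8 * length z + 16" "runs \<Delta> t (V_Start, start_tapes (K + C + 2) z) (q, ts)"
        "\<Delta> q (scanned ts) = None"
        "fst (last ts) = str_tape (output_of (if z \<in> blocks then Some (rank_in blocks z) else None))"
        using finishes_verify[of z] unfolding finishes_def by blast
      have "t \<le> poly [:16, 8:] (length z)"
        using t(1) by simp
      then show ?thesis
        using t(2-) by blast
    qed
  qed
  then show ?thesis
    unfolding semistrong_P_rankable_def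
    by (intro exI[of _ "\<lambda>z. if z \<in> blocks then Some (rank_in blocks z) else None"]) auto
qed

text \<open>Membership reduces to a last bit in two stages, \<open>x\<close> to its query and the
  query to the output of \<open>f\<close>. The query lies outside \<open>blocks\<close>, so
  \<open>f\<close> returns its rank in the complement, and an even rank ends in 1 when
  output.\<close>

lemma language_class_P:
  assumes "semistrong_P_rankable (- blocks)"
  shows "language (M False) \<in> class_P"
proof -
  obtain f where f: "polytime_computable (\<lambda>x. output_of (f x))"
    "\<And>x. x \<in> - blocks \<Longrightarrow> f x = Some (rank_in (- blocks) x)"
    using assms unfolding semistrong_P_rankable_def by blast
  have "{y. output_of (f y) \<in> {u. u \<noteq> [] \<and> last u}} \<in> class_P"
    by (rule class_P_reduction[OF f(1) last_bit_class_P])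
  from class_P_reduction[OF polytime_computable_query[of C] this]
  have "{x. query x \<in> {y. output_of (f y) \<in> {u. u \<noteq> [] \<and> last u}}} \<in> class_P"
    by (simp add: query_def)
  moreover have "output_of (f (query x)) \<in> {u. u \<noteq> [] \<and> last u} \<longleftrightarrow> x \<in> language (M False)" for x
    using f(2)[of "query x"] query_notin_blocks[of x] even_rank_in_compl_query[of x]
      last_output_of[of "rank_in (- blocks) (query x)"] by simp
  ultimately show ?thesis
    by simp
qed

end

section \<open>From unambiguous machines to the theorem\<close>

lemma UP_Int_coUP_witness_blocks:
  assumes "L \<in> class_UP" "- L \<in> class_UP"
  obtains M T C where "clocked_witness_blocks M T C" "language (M False) = L"
proof -
  obtain M\<^sub>0 M\<^sub>1 where M: "L = language M\<^sub>0" "wf_tm M\<^sub>0" "poly_time M\<^sub>0"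
    "\<forall>x cs ds. accepting_path M\<^sub>0 x cs \<longrightarrow> accepting_path M\<^sub>0 x ds \<longrightarrow> cs = ds"
    "- L = language M\<^sub>1" "wf_tm M\<^sub>1" "poly_time M\<^sub>1"
    "\<forall>x cs ds. accepting_path M\<^sub>1 x cs \<longrightarrow> accepting_path M\<^sub>1 x ds \<longrightarrow> cs = ds"
    using assms unfolding class_UP_def by blast
  define M where "M b = (if b then M\<^sub>1 else M\<^sub>0)" for b
  have wf: "wf_tm (M b)" and poly: "poly_time (M b)" for b
    using M by (auto simp: M_def)
  have "\<exists>ts. set ts = transitions (M b) \<and> distinct ts" for b
    using wf[of b] finite_distinct_list unfolding wf_tm_def by blast
  then obtain T where T: "\<And>b. set (T b) = transitions (M b) \<and> distinct (T b)"
    by metis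
  have "\<exists>p. \<forall>x t d. (step (M b) ^^ t) (init_config (M b) x) d \<longrightarrow> t \<le> poly p (length x)" for b
    using poly_time_halting_run[OF poly[of b]] by blast
  then obtain p where p: "\<And>b x t d. (step (M b) ^^ t) (init_config (M b) x) d \<Longrightarrow> t \<le> poly (p b) (length x)"
    by metis
  \<comment> \<open>One bound for both machines: \<open>(length (T b) + 1) * t\<close> covers both
    \<open>length (T b) * t\<close> and \<open>t\<close>, and the final 1 makes the bound strict, as
    the clause \<open>t < G (length x)\<close> requires.\<close>
  define s where "s = [:length (T False) + 1:] * p False + [:length (T True) + 1:] * p True + 1"
  obtain C where C: "\<And>n. poly s n \<le> ticks C n"
    using ticks_dominates by blast
  have "clocked_witness_blocks M T C"
  proof (intro clocked_witness_blocks.intro witness_blocks.intro)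
    fix b
    show "choice_list (M b) (T b)"
      using T wf by unfold_locales auto
  next
    show "language (M True) = - language (M False)"
      using M by (simp add: M_def)
  next
    fix b x cs ds
    show "accepting_path (M b) x cs \<Longrightarrow> accepting_path (M b) x ds \<Longrightarrow> cs = ds"
      using M(4,8) by (cases b) (auto simp: M_def)
  next
    show "mono (ticks C)"
      by (rule mono_ticks)
  next
    fix b t x d
    assume "(step (M b) ^^ t) (init_config (M b) x) d"
    then have "t \<le> poly (p b) (length x)"
      by (rule p)
    then have "(length (T b) + 1) * t \<le> (length (T b) + 1) * poly (p b) (length x)"
      by (rule mult_le_mono2)
    also have "\<dots> < poly s (length x)"
      by (cases b) (auto simp: s_def)
    also have "\<dots> \<le> ticks C (length x)"
      by (rule C)
    finally show "length (T b) * t \<le> ticks C (length x) \<and> t < ticks C (length x)"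
      by auto
  qed
  then show thesis
    using that M(1) by (simp add: M_def)
qed

theorem theorem16:
  assumes "\<forall>A. semistrong_P_rankable A \<longrightarrow> semistrong_P_rankable (- A)"
  shows "class_P = class_UP \<inter> class_coUP"
proof
  show "class_P \<subseteq> class_UP \<inter> class_coUP"
  proof
    fix L
    assume "L \<in> class_P"
    then have "L \<in> class_UP" "- L \<in> class_UP"
      using class_P_subset_class_UP class_P_compl by blast+
    then show "L \<in> class_UP \<inter> class_coUP"
      unfolding class_coUP_def by (metis (mono_tags, lifting) IntI double_complement mem_Collect_eq)
  qed
  show "class_UP \<inter> class_coUP \<subseteq> class_P"
  proof
    fix L
    assume "L \<in> class_UP \<inter> class_coUP"
    then have "L \<in> class_UP" "- L \<in> class_UP"
      by (auto simp: class_coUP_def)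
    then obtain M T C where W: "clocked_witness_blocks M T C" "language (M False) = L"
      by (rule UP_Int_coUP_witness_blocks)
    have "semistrong_P_rankable (- witness_blocks.blocks M T (ticks C))"
      using assms clocked_witness_blocks.semistrong_P_rankable_blocks[OF W(1)] by blast
    then show "L \<in> class_P"
      using clocked_witness_blocks.language_class_P[OF W(1)] W(2) by simp
  qed
qed

end
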